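(* Let $A$ be a Hermitian unital Banach $\ast$-algebra. If $x,y\in \mathrm{Inv}(A)$ and $\nu$ is a real number, then $$x\circledS_{\nu} y=|x|^{2}\,\sharp_{\nu}\,|y|^{2}.$$
   Context: A unital Banach $\ast$-algebra $A$ (unit $1$) is called Hermitian if every selfadjoint $a\in A$ (i.e. $a^{\ast}=a$) has spectrum $\sigma(a)\subset\mathbb{R}$. The involution is not assumed continuous. $\mathrm{Inv}(A)$ is the set of invertible elements. Write $a\geq 0$ if $a^{\ast}=a$ and $\sigma(a)\subset[0,\infty)$; write $a>0$ if $a\geq 0$ and $0\notin\sigma(a)$. Real powers: for $a>0$ and $\alpha\in\mathbb{R}$, $a^{\alpha}:=\frac{1}{2\pi i}\int_{\gamma}z^{\alpha}(z-a)^{-1}dz$, where $z^{\alpha}$ is the principal power and $\gamma$ is a closed rectifiable curve in $\{\mathrm{Re}\,z>0\}$ enclosing $\sigma(a)$ (winding once counterclockwise); this is the holomorphic functional calculus. Modulus: for $c\in\mathrm{Inv}(A)$ one has $c^{\ast}c>0$ (Shirali-Ford theorem), and $|c|:=(c^{\ast}c)^{1/2}$. Weighted geometric mean: for $a,b>0$ and $\nu\in\mathbb{R}$, $a\,\sharp_{\nu}\,b:=a^{1/2}\left(a^{-1/2}ba^{-1/2}\right)^{\nu}a^{1/2}$. Quadratic weighted geometric mean: for $x,y\in\mathrm{Inv}(A)$ and $\nu\in\mathbb{R}$, $x\circledS_{\nu}y:=x^{\ast}\left((x^{\ast})^{-1}y^{\ast}yx^{-1}\right)^{\nu}x=x^{\ast}|yx^{-1}|^{2\nu}x=\left||yx^{-1}|^{\nu}x\right|^{2}$.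 *)

theory Defs
  imports "HOL-Complex_Analysis.Complex_Analysis"
begin

(* The norm is submultiplicative; the normalisation norm 1 = 1 is not assumed. *)
class complex_banach_algebra = ring_1 + real_normed_algebra + banach +
  fixes scaleC :: "complex \<Rightarrow> 'a \<Rightarrow> 'a"  (infixr \<open>*\<^sub>C\<close> 75)
  assumes scaleR_scaleC: "r *\<^sub>R x = complex_of_real r *\<^sub>C x"
    and scaleC_add_right: "c *\<^sub>C (x + y) = c *\<^sub>C x + c *\<^sub>C y"
    and scaleC_add_left: "(c + d) *\<^sub>C x = c *\<^sub>C x + d *\<^sub>C x"
    and scaleC_scaleC: "c *\<^sub>C (d *\<^sub>C x) = (c * d) *\<^sub>C x"
    and mult_scaleC_left: "(c *\<^sub>C x) * y = c *\<^sub>C (x * y)"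
    and mult_scaleC_right: "x * (c *\<^sub>C y) = c *\<^sub>C (x * y)"
    and norm_scaleC: "norm (c *\<^sub>C x) = cmod c * norm x"

(* No continuity of the involution is assumed. *)
class banach_star_algebra = complex_banach_algebra +
  fixes star :: "'a \<Rightarrow> 'a"
  assumes star_star: "star (star x) = x"
    and star_add: "star (x + y) = star x + star y"
    and star_mult: "star (x * y) = star y * star x"
    and star_scaleC: "star (c *\<^sub>C x) = cnj c *\<^sub>C star x"

definition Inv :: "'a::ring_1 set" where
  "Inv = {x. \<exists>y. x * y = 1 \<and> y * x = 1}"

definition alg_inv :: "'a::ring_1 \<Rightarrow> 'a" where
  "alg_inv x = (THE y. x * y = 1 \<and> y * x = 1)"

definition spectrum :: "'a::complex_banach_algebra \<Rightarrow> complex set" where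
  "spectrum a = {z. z *\<^sub>C 1 - a \<notin> Inv}"

definition hermitian :: "'a::banach_star_algebra itself \<Rightarrow> bool" where
  "hermitian _ \<longleftrightarrow> (\<forall>a::'a. star a = a \<longrightarrow> spectrum a \<subseteq> \<real>)"

(* The library's contour integral is restricted to complex-valued integrands;
   this is the same formula for integrands with values in the algebra. *)
definition alg_contour_integral ::
  "(real \<Rightarrow> complex) \<Rightarrow> (complex \<Rightarrow> 'a::complex_banach_algebra) \<Rightarrow> 'a" where
  "alg_contour_integral g f =
     integral {0..1} (\<lambda>t. vector_derivative g (at t within {0..1}) *\<^sub>C f (g t))"

definition encloses :: "(real \<Rightarrow> complex) \<Rightarrow> complex set \<Rightarrow> bool" where
  "encloses g S \<longleftrightarrow>
     valid_path g \<and> pathfinish g = pathstart g \<and>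
     path_image g \<subseteq> {z. Re z > 0} - S \<and>
     (\<forall>z\<in>S. winding_number g z = 1)"

(* Meant for selfadjoint a with spectrum in the open positive half-line. The
   value does not depend on the enclosing curve, so an arbitrary one is chosen. *)
definition apowr :: "'a::complex_banach_algebra \<Rightarrow> real \<Rightarrow> 'a"  (infixr \<open>apowr\<close> 80) where
  "a apowr \<alpha> =
     (1 / (2 * of_real pi * \<i>)) *\<^sub>C
       alg_contour_integral (SOME g. encloses g (spectrum a))
         (\<lambda>z. (z powr complex_of_real \<alpha>) *\<^sub>C alg_inv (z *\<^sub>C 1 - a))"

definition modulus :: "'a::banach_star_algebra \<Rightarrow> 'a" where
  "modulus c = (star c * c) apowr (1/2)"

definition wgeo_mean :: "real \<Rightarrow> 'a::banach_star_algebra \<Rightarrow> 'a \<Rightarrow> 'a" where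
  "wgeo_mean \<nu> a b =
     (a apowr (1/2)) * (((a apowr (-1/2)) * b * (a apowr (-1/2))) apowr \<nu>) * (a apowr (1/2))"

definition quad_wgeo_mean :: "real \<Rightarrow> 'a::banach_star_algebra \<Rightarrow> 'a \<Rightarrow> 'a" where
  "quad_wgeo_mean \<nu> x y =
     star x * ((alg_inv (star x) * star y * y * alg_inv x) apowr \<nu>) * x"

end

theory Submission
  imports Defs
begin

text \<open>
  Put \<open>a = x\<^sup>* x\<close>, \<open>b = y\<^sup>* y\<close>, \<open>p = a\<^bsup>1/2\<^esup>\<close>, \<open>q = a\<^bsup>-1/2\<^esup>\<close> and \<open>u = x q\<close>. Then \<open>x = u p\<close>
  and \<open>x\<^sup>* = a x\<^sup>-\<^sup>1 = p u\<^sup>-\<^sup>1\<close>, so the element \<open>(x\<^sup>*)\<^sup>-\<^sup>1 b x\<^sup>-\<^sup>1\<close> under the power on the left-hand side is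
  \<open>u m u\<^sup>-\<^sup>1\<close> with \<open>m = q b q\<close>, the element under the power on the right-hand side. Functional
  calculus commutes with similarity, hence
  \<open>x\<^sup>* (u m u\<^sup>-\<^sup>1)\<^sup>\<nu> x = p u\<^sup>-\<^sup>1 u m\<^sup>\<nu> u\<^sup>-\<^sup>1 u p = p m\<^sup>\<nu> p\<close>.

  Two bodies of theory stand behind this computation. The first is the law
  \<open>a\<^bsup>\<alpha>\<^esup> a\<^bsup>\<beta>\<^esup> = a\<^bsup>\<alpha> + \<beta>\<^esup>\<close> for powers given by an arbitrary enclosing curve (\<open>apowr_add\<close>). Cauchy's
  theorem for algebra-valued integrands is reduced to the scalar theorem by means of bounded
  complex-linear functionals, which separate points by the Hahn-Banach theorem
  (\<open>exists_real_functional\<close>, \<open>eq_of_cfunctionals\<close>). On a circle around the spectrum the calculus is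
  multiplicative by the resolvent identity and an exchange of two integrals (\<open>circle_calc_mult\<close>),
  and every enclosing curve gives the same integral as such a circle
  (\<open>contour_integral_encloses_circle\<close>).

  The second is the Shirali-Ford theorem, that \<open>x\<^sup>* x\<close> has nonnegative spectrum (\<open>Shirali_Ford\<close>);
  it makes the powers in the statement meaningful. The proof follows Ptak. A selfadjoint \<open>a\<close> with
  positive spectrum has a selfadjoint square root although the involution may be
  discontinuous (\<open>exists_selfadjoint_sqrt\<close>). It follows that \<open>1 - x\<close> is invertible
  if \<open>\<sigma>(x\<^sup>* x) < 1\<close> (\<open>Inv_one_minus_of_star_mult_less\<close>), that products of selfadjoint contractions in
  the sense of the spectral radius are again such contractions, and that sums of positive elements are
  positive (\<open>nonneg_add\<close>). A negative spectral value of some \<open>x\<^sup>* x\<close> could then be doubled again and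
  again inside the unit disc (\<open>double_negative_spectral_value\<close>), which is absurd.
\<close>

section \<open>Invertible elements and the spectrum\<close>

lemma InvI: "x * y = 1 \<Longrightarrow> y * x = 1 \<Longrightarrow> x \<in> Inv"
  unfolding Inv_def by blast

lemma alg_inv_unique: "x * y = 1 \<Longrightarrow> y * x = 1 \<Longrightarrow> alg_inv x = y"
  for x :: "'a::ring_1"
  unfolding alg_inv_def
  by (rule the_equality) (blast, metis mult.assoc mult_1_left mult_1_right)

lemma
  fixes x :: "'a::ring_1"
  assumes "x \<in> Inv"
  shows alg_inv_right: "x * alg_inv x = 1" and alg_inv_left: "alg_inv x * x = 1"
  using assms alg_inv_unique unfolding Inv_def by auto

lemma Inv_alg_inv: "x \<in> Inv \<Longrightarrow> alg_inv x \<in> Inv"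
  by (metis InvI alg_inv_left alg_inv_right)

lemma alg_inv_cancel_right: "x \<in> Inv \<Longrightarrow> x * (alg_inv x * y) = y"
  and alg_inv_cancel_left: "x \<in> Inv \<Longrightarrow> alg_inv x * (x * y) = y"
  for x :: "'a::ring_1"
  by (simp_all add: alg_inv_left alg_inv_right flip: mult.assoc)

lemma Inv_mult: "x \<in> Inv \<Longrightarrow> y \<in> Inv \<Longrightarrow> x * y \<in> Inv"
  for x y :: "'a::ring_1"
  by (rule InvI[of _ "alg_inv y * alg_inv x"])
    (simp_all add: mult.assoc alg_inv_cancel_left alg_inv_cancel_right alg_inv_left alg_inv_right)

lemma Inv_uminus: "x \<in> Inv \<Longrightarrow> - x \<in> Inv"
  for x :: "'a::ring_1"
  by (rule InvI[of _ "- alg_inv x"]) (simp_all add: alg_inv_left alg_inv_right)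

lemma Inv_of_one_sided:
  fixes x :: "'a::ring_1"
  assumes "u * x = 1" "x * v = 1"
  shows "x \<in> Inv"
  by (metis InvI assms mult.assoc mult_1_left mult_1_right)

text \<open>For commuting \<open>x\<close> and \<open>y\<close> the two hypotheses coincide, and the lemma splits an
  invertible product into invertible factors.\<close>

lemma Inv_left_factor:
  fixes x y :: "'a::ring_1"
  assumes "x * y \<in> Inv" "y * x \<in> Inv"
  shows "x \<in> Inv"
proof (rule Inv_of_one_sided)
  show "(alg_inv (y * x) * y) * x = 1"
    using alg_inv_left[OF assms(2)] by (simp add: mult.assoc)
  show "x * (y * alg_inv (x * y)) = 1"
    using alg_inv_right[OF assms(1)] by (simp add: mult.assoc)
qed

lemma Inv_mult_left_iff: "u \<in> Inv \<Longrightarrow> u * x \<in> Inv \<longleftrightarrow> x \<in> Inv"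
  for x u :: "'a::ring_1"
  by (metis Inv_alg_inv Inv_mult alg_inv_cancel_left)

lemma Inv_mult_right_iff: "u \<in> Inv \<Longrightarrow> x * u \<in> Inv \<longleftrightarrow> x \<in> Inv"
  for x u :: "'a::ring_1"
  using Inv_mult[of "x * u" "alg_inv u"] Inv_mult[of x u]
  by (auto simp: mult.assoc alg_inv_right Inv_alg_inv)

lemma alg_inv_commute:
  fixes x y :: "'a::ring_1"
  assumes "x \<in> Inv" "x * y = y * x"
  shows "alg_inv x * y = y * alg_inv x"
proof -
  have "alg_inv x * y = alg_inv x * (y * x) * alg_inv x"
    using assms(1) by (simp add: mult.assoc alg_inv_right)
  also have "\<dots> = alg_inv x * (x * y) * alg_inv x"
    by (simp only: assms(2))
  also have "\<dots> = y * alg_inv x"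
    using assms(1) by (simp add: mult.assoc alg_inv_cancel_left)
  finally show ?thesis .
qed

text \<open>Jacobson's identity: a geometric series for the inverse of \<open>1 - b a\<close>, rearranged in
  terms of the inverse of \<open>1 - a b\<close>, shows what the former has to be.\<close>

lemma Inv_one_minus_swap:
  fixes a b :: "'a::ring_1"
  assumes "1 - a * b \<in> Inv"
  shows "1 - b * a \<in> Inv"
proof -
  define c where "c = alg_inv (1 - a * b)"
  have c: "c - c * a * b = 1" "c - a * b * c = 1"
    using alg_inv_left[OF assms] alg_inv_right[OF assms]
    unfolding c_def[symmetric] by (simp_all add: algebra_simps)
  have "(1 - b * a) * (1 + b * c * a) = 1 - b * a + b * (c - a * b * c) * a"
    by (simp add: algebra_simps)
  moreover have "(1 + b * c * a) * (1 - b * a) = 1 - b * a + b * (c - c * a * b) * a"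
    by (simp add: algebra_simps)
  ultimately show ?thesis
    by (intro InvI[of _ "1 + b * c * a"]) (simp_all add: c)
qed

lemma scaleC_bounded_bilinear:
  "bounded_bilinear (scaleC :: complex \<Rightarrow> 'a \<Rightarrow> 'a::complex_banach_algebra)"
proof
  show "\<exists>K. \<forall>a (b::'a). norm (a *\<^sub>C b) \<le> norm a * norm b * K"
    by (rule exI[of _ 1]) (simp add: norm_scaleC)
qed (simp_all add: scaleC_add_left scaleC_add_right scaleR_scaleC scaleC_scaleC scaleR_conv_of_real mult.commute)

lemmas bounded_linear_scaleC_left = bounded_bilinear.bounded_linear_left[OF scaleC_bounded_bilinear]
lemmas bounded_linear_scaleC_right = bounded_bilinear.bounded_linear_right[OF scaleC_bounded_bilinear]

lemmas scaleC_zero_left [simp] = bounded_bilinear.zero_left[OF scaleC_bounded_bilinear]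
lemmas scaleC_zero_right [simp] = bounded_bilinear.zero_right[OF scaleC_bounded_bilinear]
lemmas scaleC_minus_left [simp] = bounded_bilinear.minus_left[OF scaleC_bounded_bilinear]
lemmas scaleC_minus_right [simp] = bounded_bilinear.minus_right[OF scaleC_bounded_bilinear]
lemmas scaleC_diff_left = bounded_bilinear.diff_left[OF scaleC_bounded_bilinear]
lemmas scaleC_diff_right = bounded_bilinear.diff_right[OF scaleC_bounded_bilinear]

lemma scaleC_one [simp]: "1 *\<^sub>C x = x" for x :: "'a::complex_banach_algebra"
  using scaleR_scaleC[of 1 x] by simp

lemma scaleC_2: "2 *\<^sub>C x = x + x" for x :: "'a::complex_banach_algebra"
  using scaleC_add_left[of 1 1 x] by simp

lemmas scaleC_simps = scaleC_add_left scaleC_add_right scaleC_diff_left scaleC_diff_right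
  scaleC_scaleC mult_scaleC_left mult_scaleC_right

lemma Inv_scaleC: "x \<in> Inv \<Longrightarrow> c \<noteq> 0 \<Longrightarrow> c *\<^sub>C x \<in> Inv"
  for x :: "'a::complex_banach_algebra"
  by (rule InvI[of _ "(1/c) *\<^sub>C alg_inv x"]) (simp_all add: scaleC_simps alg_inv_left alg_inv_right)

lemma Inv_scaleC_iff: "c \<noteq> 0 \<Longrightarrow> c *\<^sub>C x \<in> Inv \<longleftrightarrow> x \<in> Inv"
  for x :: "'a::complex_banach_algebra"
  using Inv_scaleC[of "c *\<^sub>C x" "1/c"] Inv_scaleC[of x c] by (auto simp: scaleC_scaleC)

lemma Inv_uminus_iff: "- x \<in> Inv \<longleftrightarrow> x \<in> Inv"
  for x :: "'a::ring_1"
  using Inv_uminus[of x] Inv_uminus[of "- x"] by auto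

lemma spectrum_iff: "z \<in> spectrum a \<longleftrightarrow> z *\<^sub>C 1 - a \<notin> Inv"
  by (simp add: spectrum_def)

lemma spectrum_scaleC:
  assumes "c \<noteq> 0"
  shows "z \<in> spectrum (c *\<^sub>C a) \<longleftrightarrow> z / c \<in> spectrum a"
proof -
  have "c *\<^sub>C ((z / c) *\<^sub>C 1 - a) = z *\<^sub>C 1 - c *\<^sub>C a"
    using assms by (simp add: scaleC_simps)
  thus ?thesis
    using Inv_scaleC_iff[OF assms, of "(z / c) *\<^sub>C 1 - a"] by (simp add: spectrum_iff)
qed

lemma spectrum_uminus: "z \<in> spectrum (- a) \<longleftrightarrow> - z \<in> spectrum a"
  using spectrum_scaleC[of "-1" z a] by simp

lemma spectrum_shift: "z \<in> spectrum (c *\<^sub>C 1 + a) \<longleftrightarrow> z - c \<in> spectrum a"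
  by (simp add: spectrum_iff scaleC_simps diff_diff_eq)

lemma spectrum_one_plus: "z \<in> spectrum (1 + a) \<longleftrightarrow> z - 1 \<in> spectrum a"
  using spectrum_shift[of z 1 a] by simp

lemma spectrum_swap:
  assumes "z \<noteq> 0"
  shows "z \<in> spectrum (a * b) \<longleftrightarrow> z \<in> spectrum (b * a)"
proof -
  have *: "z *\<^sub>C 1 - u * v \<in> Inv \<longleftrightarrow> 1 - ((1/z) *\<^sub>C u) * v \<in> Inv" for u v :: 'a
  proof -
    have "z *\<^sub>C (1 - ((1/z) *\<^sub>C u) * v) = z *\<^sub>C 1 - u * v"
      using assms by (simp add: scaleC_simps)
    thus ?thesis
      using Inv_scaleC_iff[OF assms, of "1 - ((1/z) *\<^sub>C u) * v"] by simp
  qed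
  have "1 - ((1/z) *\<^sub>C a) * b \<in> Inv \<longleftrightarrow> 1 - ((1/z) *\<^sub>C b) * a \<in> Inv"
    using Inv_one_minus_swap[of "(1/z) *\<^sub>C a" b] Inv_one_minus_swap[of b "(1/z) *\<^sub>C a"]
    by (auto simp: mult_scaleC_left mult_scaleC_right)
  thus ?thesis
    by (simp add: spectrum_iff *)
qed

lemma spectrum_similar:
  assumes "u \<in> Inv"
  shows "spectrum (u * a * alg_inv u) = spectrum a"
proof -
  have "z *\<^sub>C 1 - u * a * alg_inv u = u * (z *\<^sub>C 1 - a) * alg_inv u" for z
    using assms by (simp add: algebra_simps scaleC_simps alg_inv_right)
  thus ?thesis
    using assms by (simp add: spectrum_def Inv_mult_left_iff Inv_mult_right_iff Inv_alg_inv)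
qed

section \<open>The resolvent\<close>

lemma norm_power_Suc_le: "norm (x ^ Suc n) \<le> norm x ^ Suc n"
  for x :: "'a::complex_banach_algebra"
proof (induction n)
  case (Suc n)
  have "norm (x ^ Suc (Suc n)) \<le> norm x * norm (x ^ Suc n)"
    by (metis norm_mult_ineq power_Suc)
  also have "\<dots> \<le> norm x * norm x ^ Suc n"
    by (rule mult_left_mono[OF Suc]) simp
  finally show ?case by simp
qed simp

text \<open>The inverse is the Neumann series. Since \<open>norm 1\<close> need not be \<open>1\<close>, the geometric bound
  on \<open>norm (x ^ n)\<close> is available from the exponent \<open>1\<close> on only.\<close>

lemma Inv_one_minus:
  fixes x :: "'a::complex_banach_algebra"
  assumes "norm x < 1"
  shows "1 - x \<in> Inv"
proof -
  have "summable (\<lambda>n. norm x ^ Suc n)"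
    unfolding summable_Suc_iff by (rule summable_geometric) (use assms in simp)
  hence "summable (\<lambda>n. norm (x ^ Suc n))"
    by (rule summable_comparison_test'[where N = 0]) (simp add: norm_power_Suc_le del: power_Suc)
  hence "summable (\<lambda>n. x ^ Suc n)"
    by (rule summable_norm_cancel)
  hence sm: "summable (\<lambda>n. x ^ n)"
    unfolding summable_Suc_iff .
  define s where "s = (\<Sum>n. x ^ n)"
  have sums: "(\<lambda>n. x ^ n) sums s"
    unfolding s_def by (rule summable_sums[OF sm])
  have "(\<lambda>n. x ^ Suc n) sums (s - 1)"
    using sums sums_Suc_iff[of "\<lambda>n. x ^ n" "s - 1"] by simp
  moreover have "(\<lambda>n. x ^ Suc n) sums (x * s)"
    using bounded_linear.sums[OF bounded_linear_mult_right sums, of x] by simp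
  moreover have "(\<lambda>n. x ^ Suc n) sums (s * x)"
    using bounded_linear.sums[OF bounded_linear_mult_left sums, of x]
    by (simp add: power_commutes)
  ultimately have "x * s = s - 1" "s * x = s - 1"
    by (auto dest: sums_unique2)
  thus ?thesis
    by (intro InvI[of _ s]) (simp_all add: algebra_simps)
qed

definition resolvent :: "'a::complex_banach_algebra \<Rightarrow> complex \<Rightarrow> 'a" where
  "resolvent a z = alg_inv (z *\<^sub>C 1 - a)"

lemma
  assumes "z \<notin> spectrum a"
  shows resolvent_right: "(z *\<^sub>C 1 - a) * resolvent a z = 1"
    and resolvent_left: "resolvent a z * (z *\<^sub>C 1 - a) = 1"
  using assms by (simp_all add: resolvent_def spectrum_iff alg_inv_right alg_inv_left)

lemma scaleC_resolvent:
  assumes "z \<notin> spectrum a"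
  shows "z *\<^sub>C resolvent a z = 1 + a * resolvent a z"
  using resolvent_right[OF assms] by (simp add: algebra_simps mult_scaleC_left)

lemma resolvent_identity:
  assumes "z \<notin> spectrum a" "w \<notin> spectrum a"
  shows "resolvent a z - resolvent a w = (w - z) *\<^sub>C (resolvent a z * resolvent a w)"
proof -
  have "resolvent a z - resolvent a w
      = resolvent a z * ((w *\<^sub>C 1 - a) * resolvent a w)
        - (resolvent a z * (z *\<^sub>C 1 - a)) * resolvent a w"
    using assms by (simp add: resolvent_right resolvent_left)
  also have "\<dots> = resolvent a z * ((w *\<^sub>C 1 - a) - (z *\<^sub>C 1 - a)) * resolvent a w"
    by (simp add: algebra_simps)
  also have "\<dots> = (w - z) *\<^sub>C (resolvent a z * resolvent a w)"
    by (simp add: scaleC_diff_left[symmetric] mult_scaleC_left mult_scaleC_right)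
  finally show ?thesis .
qed

text \<open>The radius of stability comes from \<open>z - a = (w - a) (1 - (w - z) R(w))\<close>; the norm
  bound then follows from the resolvent identity by absorbing half of \<open>norm (R(z))\<close> on the left.\<close>

lemma resolvent_near:
  fixes a :: "'a::complex_banach_algebra"
  assumes "w \<notin> spectrum a" "cmod (z - w) * norm (resolvent a w) \<le> 1/2"
  shows "z \<notin> spectrum a" "norm (resolvent a z) \<le> 2 * norm (resolvent a w)"
proof -
  have nq: "norm ((w - z) *\<^sub>C resolvent a w) \<le> 1/2"
    using assms(2) by (simp add: norm_scaleC norm_minus_commute)
  have "(w *\<^sub>C 1 - a) * (1 - (w - z) *\<^sub>C resolvent a w) = z *\<^sub>C 1 - a"
    using resolvent_right[OF assms(1)]
    by (simp add: right_diff_distrib mult_scaleC_right scaleC_diff_left)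
  moreover have "1 - (w - z) *\<^sub>C resolvent a w \<in> Inv"
    using nq by (intro Inv_one_minus) simp
  ultimately show z: "z \<notin> spectrum a"
    using assms(1) by (metis Inv_mult spectrum_iff)
  have "resolvent a z = resolvent a w + resolvent a z * ((w - z) *\<^sub>C resolvent a w)"
    using resolvent_identity[OF z assms(1)] by (simp add: mult_scaleC_right algebra_simps)
  hence "norm (resolvent a z) \<le> norm (resolvent a w) + norm (resolvent a z) * norm ((w - z) *\<^sub>C resolvent a w)"
    by (metis norm_triangle_le norm_mult_ineq add_left_mono)
  also have "\<dots> \<le> norm (resolvent a w) + norm (resolvent a z) * (1/2)"
    using nq by (intro add_left_mono mult_left_mono) auto
  finally show "norm (resolvent a z) \<le> 2 * norm (resolvent a w)" by simp
qed

lemma resolvent_near_ball: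
  fixes a :: "'a::complex_banach_algebra"
  assumes "w \<notin> spectrum a"
  obtains d where "d > 0" "\<And>z. cmod (z - w) < d \<Longrightarrow> cmod (z - w) * norm (resolvent a w) \<le> 1/2"
proof -
  define d where "d = 1 / (2 * (norm (resolvent a w) + 1))"
  have pos: "norm (resolvent a w) + 1 > 0"
    by (smt (verit) norm_ge_zero)
  have "cmod (z - w) * norm (resolvent a w) \<le> 1/2" if "cmod (z - w) < d" for z
  proof -
    have "cmod (z - w) * norm (resolvent a w) \<le> d * (norm (resolvent a w) + 1)"
      using that pos by (intro mult_mono) (auto simp: d_def)
    also have "\<dots> = 1/2"
      using pos by (simp add: d_def)
    finally show ?thesis .
  qed
  moreover have "d > 0" using pos by (simp add: d_def)
  ultimately show ?thesis using that by blast
qed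

lemma closed_spectrum: "closed (spectrum a)"
proof -
  have "open (- spectrum a)"
    unfolding open_dist
  proof
    fix w assume "w \<in> - spectrum a"
    then obtain d where d: "d > 0" "\<And>z. cmod (z - w) < d \<Longrightarrow> cmod (z - w) * norm (resolvent a w) \<le> 1/2"
      using resolvent_near_ball[of w a] by auto
    then show "\<exists>e>0. \<forall>y. dist y w < e \<longrightarrow> y \<in> - spectrum a"
      using resolvent_near(1)[of w a] \<open>w \<in> - spectrum a\<close> by (intro exI[of _ d]) (auto simp: dist_norm)
  qed
  thus ?thesis by (simp add: closed_def)
qed

lemma spectrum_norm_le:
  assumes "z \<in> spectrum a"
  shows "cmod z \<le> norm a"
proof (rule ccontr)
  assume "\<not> cmod z \<le> norm a"
  hence z: "z \<noteq> 0" "norm a < cmod z" by auto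
  have "norm ((1/z) *\<^sub>C a) < 1"
    using z by (simp add: norm_scaleC norm_divide)
  hence "z *\<^sub>C (1 - (1/z) *\<^sub>C a) \<in> Inv"
    using z by (intro Inv_scaleC Inv_one_minus)
  also have "z *\<^sub>C (1 - (1/z) *\<^sub>C a) = z *\<^sub>C 1 - a"
    using z by (simp add: scaleC_simps)
  finally show False using assms by (simp add: spectrum_iff)
qed

lemma compact_spectrum: "compact (spectrum a)"
  by (auto simp: compact_eq_bounded_closed closed_spectrum bounded_iff intro: spectrum_norm_le)

text \<open>Decay of the resolvent at infinity; this is what fixes the value of its integral over a
  large circle.\<close>

lemma norm_resolvent_le:
  assumes "norm a < cmod z"
  shows "norm (resolvent a z) \<le> norm (1::'a::complex_banach_algebra) / (cmod z - norm (a::'a))"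
proof -
  have "z \<notin> spectrum a"
    using assms spectrum_norm_le[of z a] by auto
  hence "cmod z * norm (resolvent a z) = norm (1 + a * resolvent a z)"
    by (simp add: norm_scaleC flip: scaleC_resolvent)
  also have "\<dots> \<le> norm (1::'a) + norm a * norm (resolvent a z)"
    by (meson norm_triangle_le norm_mult_ineq add_left_mono)
  finally show ?thesis
    using assms by (simp add: field_simps)
qed

section \<open>Complex differentiable functions with values in the algebra\<close>

text \<open>Complex differentiability at every point of a (usually open) set, for functions with values in
  the algebra, where \<open>holomorphic_on\<close> does not apply.\<close>

definition cdiff_on :: "(complex \<Rightarrow> 'a::complex_banach_algebra) \<Rightarrow> complex set \<Rightarrow> bool" where
  "cdiff_on F S \<longleftrightarrow> (\<forall>z\<in>S. \<exists>D. (F has_derivative (\<lambda>h. h *\<^sub>C D)) (at z))"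

lemma cdiff_on_subset: "cdiff_on F S \<Longrightarrow> T \<subseteq> S \<Longrightarrow> cdiff_on F T"
  unfolding cdiff_on_def by blast

lemma cdiff_on_continuous: "cdiff_on F S \<Longrightarrow> continuous_on S F"
  unfolding cdiff_on_def
  by (meson continuous_at_imp_continuous_on has_derivative_continuous)

lemma cdiff_on_resolvent: "cdiff_on (resolvent a) (- spectrum a)"
  unfolding cdiff_on_def
proof
  fix w assume "w \<in> - spectrum a"
  hence w: "w \<notin> spectrum a" by simp
  define N where "N = norm (resolvent a w)"
  obtain d where d: "d > 0" "\<And>z. cmod (z - w) < d \<Longrightarrow> cmod (z - w) * N \<le> 1/2"
    unfolding N_def by (rule resolvent_near_ball[OF w]) blast
  define D where "D = - (resolvent a w * resolvent a w)"
  have bd: "norm (resolvent a z - resolvent a w - (z - w) *\<^sub>C D) \<le> (2 * N * N * N * cmod (z - w)) * cmod (z - w)"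
    if "cmod (z - w) < d" for z
  proof -
    have z: "z \<notin> spectrum a" "norm (resolvent a z) \<le> 2 * N"
      using resolvent_near[OF w] d(2)[OF that] by (auto simp: N_def)
    have "resolvent a z - resolvent a w - (z - w) *\<^sub>C D
        = (w - z) *\<^sub>C (resolvent a z * resolvent a w) - (w - z) *\<^sub>C (resolvent a w * resolvent a w)"
      by (simp add: D_def resolvent_identity[OF z(1) w] scaleC_diff_left)
    also have "\<dots> = (w - z) *\<^sub>C ((resolvent a z - resolvent a w) * resolvent a w)"
      by (simp add: scaleC_diff_right left_diff_distrib)
    also have "\<dots> = ((w - z) * (w - z)) *\<^sub>C (resolvent a z * resolvent a w * resolvent a w)"
      by (simp only: resolvent_identity[OF z(1) w] mult_scaleC_left scaleC_scaleC)
    also have "norm \<dots> \<le> (cmod (w - z) * cmod (w - z)) * (2 * N * N * N)"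
      unfolding norm_scaleC norm_mult
    proof (rule mult_left_mono)
      have "norm (resolvent a z * resolvent a w * resolvent a w) \<le> norm (resolvent a z) * N * N"
        unfolding N_def by (meson mult_right_mono norm_ge_zero norm_mult_ineq order_trans)
      also have "\<dots> \<le> 2 * N * N * N"
        using z(2) by (simp add: N_def mult_right_mono)
      finally show "norm (resolvent a z * resolvent a w * resolvent a w) \<le> 2 * N * N * N" .
    qed simp
    finally show ?thesis by (simp add: norm_minus_commute mult_ac)
  qed
  have "(resolvent a has_derivative (\<lambda>h. h *\<^sub>C D)) (at w)"
    unfolding has_derivative_at_alt
  proof (intro conjI allI impI)
    fix e :: real assume e: "e > 0"
    define k where "k = 2 * N * N * N"
    have k: "k \<ge> 0" by (simp add: k_def N_def)
    define d' where "d' = min d (e / (k + 1))"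
    have "d' > 0" using d e k by (simp add: d'_def)
    moreover have "norm (resolvent a z - resolvent a w - (z - w) *\<^sub>C D) \<le> e * norm (z - w)"
      if "norm (z - w) < d'" for z
    proof -
      have "k * cmod (z - w) \<le> (k + 1) * (e / (k + 1))"
        using that k by (intro mult_mono) (auto simp: d'_def)
      hence "k * cmod (z - w) \<le> e" using k by simp
      with bd[of z] that show ?thesis
        by (smt (verit) d'_def k_def mult_right_mono norm_ge_zero)
    qed
    ultimately show "\<exists>d>0. \<forall>y. norm (y - w) < d \<longrightarrow>
        norm (resolvent a y - resolvent a w - (y - w) *\<^sub>C D) \<le> e * norm (y - w)" by blast
  qed (rule bounded_linear_scaleC_left)
  thus "\<exists>D. (resolvent a has_derivative (\<lambda>h. h *\<^sub>C D)) (at w)" by blast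
qed

lemma cdiff_on_mult:
  assumes "cdiff_on F S" "cdiff_on G S"
  shows "cdiff_on (\<lambda>z. F z * G z) S"
  unfolding cdiff_on_def
proof
  fix z assume "z \<in> S"
  then obtain D E where "(F has_derivative (\<lambda>h. h *\<^sub>C D)) (at z)" "(G has_derivative (\<lambda>h. h *\<^sub>C E)) (at z)"
    using assms unfolding cdiff_on_def by meson
  from has_derivative_mult[OF this]
  show "\<exists>D. ((\<lambda>z. F z * G z) has_derivative (\<lambda>h. h *\<^sub>C D)) (at z)"
    by (intro exI[of _ "F z * E + D * G z"]) (simp add: scaleC_simps)
qed

lemma cdiff_on_scaleC:
  assumes "f holomorphic_on S" "open S" "cdiff_on G S"
  shows "cdiff_on (\<lambda>z. f z *\<^sub>C G z) S"
  unfolding cdiff_on_def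
proof
  fix z assume "z \<in> S"
  then obtain E where E: "(G has_derivative (\<lambda>h. h *\<^sub>C E)) (at z)"
    using assms unfolding cdiff_on_def by meson
  obtain d where "(f has_field_derivative d) (at z)"
    using assms \<open>z \<in> S\<close> holomorphic_on_imp_differentiable_at field_differentiable_def by blast
  hence "(f has_derivative (\<lambda>h. d * h)) (at z)"
    by (simp add: has_field_derivative_def)
  from bounded_bilinear.FDERIV[OF scaleC_bounded_bilinear this E]
  show "\<exists>D. ((\<lambda>z. f z *\<^sub>C G z) has_derivative (\<lambda>h. h *\<^sub>C D)) (at z)"
    by (intro exI[of _ "f z *\<^sub>C E + d *\<^sub>C G z"]) (simp add: scaleC_simps mult.commute)
qed

lemma cdiff_on_const: "cdiff_on (\<lambda>z. v) S"
  unfolding cdiff_on_def by (auto intro!: exI[of _ 0])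

section \<open>Bounded functionals separate points\<close>

text \<open>The one-dimensional step of the Hahn-Banach theorem. A linear functional dominated by
  the norm is represented by its graph \<open>M\<close>, so that partial functionals are ordered by inclusion.
  The value \<open>\<xi>\<close> at the new vector \<open>x0\<close> has to separate the numbers \<open>r - norm (x - x0)\<close> from the
  numbers \<open>norm (y + x0) - s\<close>, and the triangle inequality leaves room for it.\<close>

lemma norm_dominated_graph_extends:
  fixes M :: "('a::real_normed_vector \<times> real) set" and x0 :: 'a
  assumes sub: "subspace M" and dom: "\<And>x r. (x, r) \<in> M \<Longrightarrow> r \<le> norm x"
  obtains \<xi> where "\<And>x r t. (x, r) \<in> M \<Longrightarrow> r + t * \<xi> \<le> norm (x + t *\<^sub>R x0)"
proof -
  have zero: "(0, 0) \<in> M"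
    using subspace_0[OF sub] by (simp add: zero_prod_def)
  have sep: "r - norm (x - x0) \<le> norm (y + x0) - s" if "(x, r) \<in> M" "(y, s) \<in> M" for x r y s
  proof -
    have "(x + y, r + s) \<in> M"
      using subspace_add[OF sub that] by simp
    hence "r + s \<le> norm ((x - x0) + (y + x0))"
      using dom[of "x + y" "r + s"] by simp
    thus ?thesis
      using norm_triangle_ineq[of "x - x0" "y + x0"] by linarith
  qed
  define L where "L = (\<lambda>(x, r). r - norm (x - x0)) ` M"
  define \<xi> where "\<xi> = Sup L"
  have ne: "L \<noteq> {}" using zero by (auto simp: L_def)
  have bdd: "bdd_above L"
    unfolding L_def by (rule bdd_aboveI[of _ "norm (0 + x0) - 0"]) (use sep zero in fastforce)
  have lower: "r - norm (x - x0) \<le> \<xi>" if "(x, r) \<in> M" for x r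
    unfolding \<xi>_def by (rule cSup_upper[OF _ bdd]) (use that in \<open>force simp: L_def\<close>)
  have upper: "\<xi> \<le> norm (y + x0) - s" if "(y, s) \<in> M" for y s
    unfolding \<xi>_def by (rule cSup_least[OF ne]) (use sep that in \<open>auto simp: L_def\<close>)
  have "r + t * \<xi> \<le> norm (x + t *\<^sub>R x0)" if m: "(x, r) \<in> M" for x r t
  proof (cases t "0::real" rule: linorder_cases)
    case equal
    thus ?thesis using dom[OF m] by simp
  next
    case greater
    have "((1/t) *\<^sub>R x, r / t) \<in> M"
      using subspace_scale[OF sub m, of "1/t"] by simp
    from upper[OF this] have "t * \<xi> \<le> t * (norm ((1/t) *\<^sub>R x + x0) - r / t)"
      using greater by (simp add: mult_left_mono)
    also have "\<dots> = norm (t *\<^sub>R ((1/t) *\<^sub>R x + x0)) - r"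
      using greater by (simp only: norm_scaleR right_diff_distrib) simp
    also have "t *\<^sub>R ((1/t) *\<^sub>R x + x0) = x + t *\<^sub>R x0"
      using greater by (simp add: scaleR_add_right)
    finally show ?thesis by simp
  next
    case less
    define s where "s = - t"
    have s: "s > 0" using less by (simp add: s_def)
    have "((1/s) *\<^sub>R x, r / s) \<in> M"
      using subspace_scale[OF sub m, of "1/s"] by simp
    from lower[OF this] have "s * (r / s - norm ((1/s) *\<^sub>R x - x0)) \<le> s * \<xi>"
      using s by (simp add: mult_left_mono)
    moreover have "s * (r / s - norm ((1/s) *\<^sub>R x - x0)) = r - norm (s *\<^sub>R ((1/s) *\<^sub>R x - x0))"
      using s by (simp only: norm_scaleR right_diff_distrib) simp
    moreover have "s *\<^sub>R ((1/s) *\<^sub>R x - x0) = x + t *\<^sub>R x0"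
      using s by (simp add: scaleR_diff_right) (simp add: s_def)
    ultimately have "r - norm (x + t *\<^sub>R x0) \<le> s * \<xi>" by metis
    thus ?thesis by (simp add: s_def)
  qed
  thus ?thesis by (rule that)
qed

text \<open>Hahn-Banach: Zorn's lemma gives a maximal norm-dominated graph through \<open>(v, norm v)\<close>, and by
  the extension step a maximal graph has full domain.\<close>

lemma exists_real_functional:
  fixes v :: "'a::real_normed_vector"
  assumes "v \<noteq> 0"
  shows "\<exists>f :: 'a \<Rightarrow> real. bounded_linear f \<and> f v \<noteq> 0"
proof -
  define \<G> where "\<G> = {M :: ('a \<times> real) set. subspace M \<and> (\<forall>x r. (x, r) \<in> M \<longrightarrow> r \<le> norm x) \<and> (v, norm v) \<in> M}"
  have "\<exists>M\<in>\<G>. \<forall>X\<in>\<G>. M \<subseteq> X \<longrightarrow> X = M"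
  proof (rule subset_Zorn_nonempty)
    have "r \<le> norm x" if "(x, r) \<in> span {(v, norm v)}" for x r
      using that by (auto simp: span_singleton intro!: mult_right_mono)
    hence "span {(v, norm v)} \<in> \<G>"
      unfolding \<G>_def by (auto intro: span_base)
    thus "\<G> \<noteq> {}" by blast
  next
    fix C assume C: "C \<noteq> {}" "subset.chain \<G> C"
    have dir: "\<exists>Z\<in>C. p \<in> Z \<and> q \<in> Z" if "X \<in> C" "p \<in> X" "Y \<in> C" "q \<in> Y" for p q X Y
      using C(2) that unfolding subset_chain_def by (metis subset_iff)
    have CG: "C \<subseteq> \<G>" using C(2) unfolding subset_chain_def by blast
    show "\<Union>C \<in> \<G>"
      unfolding \<G>_def mem_Collect_eq
    proof (intro conjI allI impI)
      show "subspace (\<Union>C)"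
        unfolding subspace_def
      proof (intro conjI ballI allI)
        show "0 \<in> \<Union>C" using C(1) CG by (auto simp: \<G>_def subspace_def)
      next
        fix p q assume "p \<in> \<Union>C" "q \<in> \<Union>C"
        then obtain Z where "Z \<in> C" "p \<in> Z" "q \<in> Z" using dir by blast
        moreover have "subspace Z" using \<open>Z \<in> C\<close> CG by (auto simp: \<G>_def)
        ultimately show "p + q \<in> \<Union>C" by (blast intro: subspace_add)
      next
        fix c and p assume "p \<in> \<Union>C"
        then obtain Z where "Z \<in> C" "p \<in> Z" by blast
        moreover have "subspace Z" using \<open>Z \<in> C\<close> CG by (auto simp: \<G>_def)
        ultimately show "c *\<^sub>R p \<in> \<Union>C" by (blast intro: subspace_scale)
      qed
    next
      fix x r assume "(x, r) \<in> \<Union>C"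
      thus "r \<le> norm x" using CG by (auto simp: \<G>_def)
    next
      show "(v, norm v) \<in> \<Union>C" using C(1) CG by (auto simp: \<G>_def)
    qed
  qed
  then obtain M where M: "M \<in> \<G>" and max: "\<And>X. X \<in> \<G> \<Longrightarrow> M \<subseteq> X \<Longrightarrow> X = M" by blast
  have sub: "subspace M" and dom: "\<And>x r. (x, r) \<in> M \<Longrightarrow> r \<le> norm x" and vM: "(v, norm v) \<in> M"
    using M by (auto simp: \<G>_def)
  have ex: "\<exists>r. (x0, r) \<in> M" for x0
  proof -
    obtain \<xi> where \<xi>: "\<And>x r t. (x, r) \<in> M \<Longrightarrow> r + t * \<xi> \<le> norm (x + t *\<^sub>R x0)"
      using norm_dominated_graph_extends[OF sub dom] by metis
    define X where "X = {p + t *\<^sub>R (x0, \<xi>) | p t. p \<in> M}"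
    have "X \<in> \<G>"
      unfolding \<G>_def mem_Collect_eq
    proof (intro conjI allI impI)
      have "X = {p + q | p q. p \<in> M \<and> q \<in> span {(x0, \<xi>)}}"
        unfolding X_def span_singleton by blast
      thus "subspace X"
        using subspace_sums[OF sub subspace_span] by simp
      show "r \<le> norm x" if "(x, r) \<in> X" for x r
        using that \<xi> by (auto simp: X_def)
      show "(v, norm v) \<in> X"
        unfolding X_def using vM by (intro CollectI exI[of _ "(v, norm v)"] exI[of _ 0]) (simp add: zero_prod_def)
    qed
    moreover have "M \<subseteq> X"
    proof
      fix p assume "p \<in> M"
      thus "p \<in> X"
        unfolding X_def by (intro CollectI exI[of _ p] exI[of _ 0]) (simp add: zero_prod_def)
    qed
    moreover have "(x0, \<xi>) \<in> X"
      unfolding X_def using subspace_0[OF sub] by (intro CollectI exI[of _ 0] exI[of _ 1]) simp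
    ultimately show ?thesis using max by blast
  qed
  define f where "f x = (SOME r. (x, r) \<in> M)" for x
  have fM: "(x, f x) \<in> M" for x
    unfolding f_def by (rule someI_ex[OF ex])
  \<comment> \<open>The norm bound at \<open>0\<close> makes the subspace \<open>M\<close> single-valued.\<close>
  have uniq: "r = s" if "(x, r) \<in> M" "(x, s) \<in> M" for x r s
    using dom[of 0 "r - s"] dom[of 0 "s - r"] subspace_diff[OF sub that] subspace_diff[OF sub that(2,1)]
    by simp
  have "bounded_linear f"
  proof (rule bounded_linear_intro[where K = 1])
    show "f (x + y) = f x + f y" for x y
      using uniq[OF fM, of "x + y" "f x + f y"] subspace_add[OF sub fM fM, of x y] by simp
    show "f (c *\<^sub>R x) = c *\<^sub>R f x" for c x
      using uniq[OF fM, of "c *\<^sub>R x" "c * f x"] subspace_scale[OF sub fM, of c x] by simp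
    show "norm (f x) \<le> norm x * 1" for x
      using dom[OF fM, of x] dom[of "- x" "- f x"] subspace_neg[OF sub fM, of x] by simp
  qed
  moreover have "f v = norm v"
    using uniq[OF fM vM] .
  ultimately show ?thesis using assms by auto
qed

definition cfunctional :: "('a::complex_banach_algebra \<Rightarrow> complex) \<Rightarrow> bool" where
  "cfunctional \<phi> \<longleftrightarrow> bounded_linear \<phi> \<and> (\<forall>c x. \<phi> (c *\<^sub>C x) = c * \<phi> x)"

text \<open>A complex-linear functional is recovered from its real part \<open>f\<close> as \<open>f x - \<i> f (\<i> x)\<close>.\<close>

lemma exists_cfunctional:
  fixes v :: "'a::complex_banach_algebra"
  assumes "v \<noteq> 0"
  obtains \<phi> :: "'a \<Rightarrow> complex" where "cfunctional \<phi>" "\<phi> v \<noteq> 0"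
proof -
  obtain f :: "'a \<Rightarrow> real" where f: "bounded_linear f" "f v \<noteq> 0"
    using exists_real_functional[OF assms] by blast
  interpret f: bounded_linear f by (rule f(1))
  define \<phi> where "\<phi> x = of_real (f x) - \<i> * of_real (f (\<i> *\<^sub>C x))" for x
  have "bounded_linear (\<lambda>x. f (\<i> *\<^sub>C x))"
    by (rule bounded_linear_compose[OF f(1) bounded_linear_scaleC_right])
  hence "bounded_linear \<phi>"
    unfolding \<phi>_def
    by (intro bounded_linear_sub bounded_linear_const_mult bounded_linear_compose[OF bounded_linear_of_real] f(1))
  moreover have "\<phi> (c *\<^sub>C x) = c * \<phi> x" for c x
  proof -
    have decomp: "c *\<^sub>C x = Re c *\<^sub>R x + Im c *\<^sub>R (\<i> *\<^sub>C x)" for x :: 'a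
      unfolding scaleR_scaleC scaleC_scaleC scaleC_add_left[symmetric]
      by (subst (1) complex_eq) (simp add: mult.commute)
    have ii: "\<i> *\<^sub>C \<i> *\<^sub>C x = - x" by (simp add: scaleC_scaleC)
    have "f (\<i> *\<^sub>C c *\<^sub>C x) = Re c * f (\<i> *\<^sub>C x) - Im c * f x"
    proof -
      have "\<i> *\<^sub>C c *\<^sub>C x = c *\<^sub>C \<i> *\<^sub>C x"
        by (simp add: scaleC_scaleC mult.commute)
      also have "\<dots> = Re c *\<^sub>R (\<i> *\<^sub>C x) - Im c *\<^sub>R x"
        by (simp add: decomp[of "\<i> *\<^sub>C x"] ii)
      finally show ?thesis by (simp add: f.diff f.scaleR)
    qed
    moreover have "f (c *\<^sub>C x) = Re c * f x + Im c * f (\<i> *\<^sub>C x)"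
      by (simp add: decomp[of x] f.add f.scaleR)
    ultimately show ?thesis
      by (simp add: \<phi>_def complex_eq_iff)
  qed
  moreover have "Re (\<phi> v) = f v" by (simp add: \<phi>_def)
  ultimately show ?thesis
    using f(2) by (intro that[of \<phi>]) (auto simp: cfunctional_def)
qed

lemma eq_of_cfunctionals:
  fixes x y :: "'a::complex_banach_algebra"
  assumes "\<And>\<phi>. cfunctional \<phi> \<Longrightarrow> \<phi> x = \<phi> y"
  shows "x = y"
proof (rule ccontr)
  assume "x \<noteq> y"
  then obtain \<phi> :: "'a \<Rightarrow> complex" where "cfunctional \<phi>" "\<phi> (x - y) \<noteq> 0"
    using exists_cfunctional[of "x - y"] by auto
  thus False
    using assms[of \<phi>] by (simp add: cfunctional_def bounded_linear.linear linear_diff)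
qed

section \<open>Contour integrals of algebra-valued functions\<close>

definition alg_contour_integrable :: "(real \<Rightarrow> complex) \<Rightarrow> (complex \<Rightarrow> 'a::complex_banach_algebra) \<Rightarrow> bool" where
  "alg_contour_integrable g f \<longleftrightarrow>
     (\<lambda>t. vector_derivative g (at t within {0..1}) *\<^sub>C f (g t)) integrable_on {0..1}"

lemma cfunctional_alg_contour_integral:
  assumes "cfunctional \<phi>" "alg_contour_integrable g f"
  shows "((\<lambda>z. \<phi> (f z)) has_contour_integral \<phi> (alg_contour_integral g f)) g"
proof -
  have "bounded_linear \<phi>" and lin: "\<And>c x. \<phi> (c *\<^sub>C x) = c * \<phi> x"
    using assms(1) by (auto simp: cfunctional_def)
  from has_integral_linear[OF integrable_integral[OF assms(2)[unfolded alg_contour_integrable_def]] this(1)]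
  show ?thesis
    by (simp add: has_contour_integral_def alg_contour_integral_def o_def lin mult.commute)
qed

lemma
  assumes "bounded_linear T" "\<And>c x. T (c *\<^sub>C x) = c *\<^sub>C T x" "alg_contour_integrable g f"
  shows alg_contour_integrable_linear: "alg_contour_integrable g (\<lambda>z. T (f z))"
    and alg_contour_integral_linear: "alg_contour_integral g (\<lambda>z. T (f z)) = T (alg_contour_integral g f)"
proof -
  from has_integral_linear[OF integrable_integral[OF assms(3)[unfolded alg_contour_integrable_def]] assms(1)]
  have *: "((\<lambda>t. vector_derivative g (at t within {0..1}) *\<^sub>C T (f (g t))) has_integral
      T (alg_contour_integral g f)) {0..1}"
    by (simp add: o_def assms(2) alg_contour_integral_def)
  show "alg_contour_integrable g (\<lambda>z. T (f z))"
    using * unfolding alg_contour_integrable_def by blast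
  show "alg_contour_integral g (\<lambda>z. T (f z)) = T (alg_contour_integral g f)"
    using * unfolding alg_contour_integral_def by (simp add: integral_unique)
qed

lemma alg_contour_integral_eqI:
  fixes f k :: "complex \<Rightarrow> 'a::complex_banach_algebra"
  assumes "alg_contour_integrable g f" "alg_contour_integrable h k"
    "\<And>\<phi>. cfunctional \<phi> \<Longrightarrow> contour_integral g (\<lambda>z. \<phi> (f z)) = contour_integral h (\<lambda>z. \<phi> (k z))"
  shows "alg_contour_integral g f = alg_contour_integral h k"
proof (rule eq_of_cfunctionals)
  fix \<phi> :: "'a \<Rightarrow> complex" assume \<phi>: "cfunctional \<phi>"
  show "\<phi> (alg_contour_integral g f) = \<phi> (alg_contour_integral h k)"
    using assms(3)[OF \<phi>]
      contour_integral_unique[OF cfunctional_alg_contour_integral[OF \<phi> assms(1)]]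
      contour_integral_unique[OF cfunctional_alg_contour_integral[OF \<phi> assms(2)]] by simp
qed

lemma alg_contour_integral_cong:
  assumes "\<And>z. z \<in> path_image g \<Longrightarrow> f z = k z"
  shows "alg_contour_integral g f = alg_contour_integral g k"
  unfolding alg_contour_integral_def
  by (rule integral_cong) (simp add: assms path_image_def)

lemma alg_contour_integral_add:
  assumes "alg_contour_integrable g f" "alg_contour_integrable g k"
  shows "alg_contour_integral g (\<lambda>z. f z + k z) = alg_contour_integral g f + alg_contour_integral g k"
  using assms unfolding alg_contour_integrable_def alg_contour_integral_def
  by (simp add: scaleC_add_right integral_add)

lemma alg_contour_integral_diff:
  assumes "alg_contour_integrable g f" "alg_contour_integrable g k"
  shows "alg_contour_integral g (\<lambda>z. f z - k z) = alg_contour_integral g f - alg_contour_integral g k"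
  using assms unfolding alg_contour_integrable_def alg_contour_integral_def
  by (simp add: scaleC_diff_right integral_diff)

lemma cfunctional_cdiff_holomorphic:
  assumes "cfunctional \<phi>" "cdiff_on F S"
  shows "(\<lambda>z. \<phi> (F z)) holomorphic_on S"
  unfolding holomorphic_on_def
proof
  fix z assume "z \<in> S"
  then obtain D where D: "(F has_derivative (\<lambda>h. h *\<^sub>C D)) (at z)"
    using assms(2) unfolding cdiff_on_def by blast
  have "bounded_linear \<phi>" and lin: "\<And>c x. \<phi> (c *\<^sub>C x) = c * \<phi> x"
    using assms(1) by (auto simp: cfunctional_def)
  from bounded_linear.has_derivative[OF this(1) D]
  have "((\<lambda>z. \<phi> (F z)) has_field_derivative \<phi> D) (at z)"
    by (simp add: has_field_derivative_def lin mult.commute[of _ "\<phi> D"])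
  thus "(\<lambda>z. \<phi> (F z)) field_differentiable at z within S"
    using field_differentiable_at_within field_differentiable_def by blast
qed

lemma alg_contour_integrable_linepath:
  assumes "continuous_on (closed_segment a b) F"
  shows "alg_contour_integrable (linepath a b) F"
proof -
  have "continuous_on {0..1} (\<lambda>t. (b - a) *\<^sub>C F (linepath a b t))"
    by (intro continuous_on_compose2[OF linear_continuous_on[OF bounded_linear_scaleC_right]]
        continuous_on_compose2[OF assms] continuous_intros) (auto simp: linepath_in_path)
  hence "(\<lambda>t. (b - a) *\<^sub>C F (linepath a b t)) integrable_on {0..1}"
    by (rule integrable_continuous_real)
  thus ?thesis
    unfolding alg_contour_integrable_def
    by (rule integrable_eq) (simp add: vector_derivative_linepath_within)
qed

lemma alg_contour_integral_linepath_const: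
  "alg_contour_integral (linepath a b) (\<lambda>z. v) = (b - a) *\<^sub>C v"
proof -
  have "alg_contour_integral (linepath a b) (\<lambda>z. v) = integral {0..1::real} (\<lambda>t. (b - a) *\<^sub>C v)"
    unfolding alg_contour_integral_def
    by (rule integral_cong) (simp add: vector_derivative_linepath_within)
  thus ?thesis by simp
qed

lemma norm_alg_contour_integral_linepath_le:
  assumes "alg_contour_integrable (linepath a b) F" "\<And>z. z \<in> closed_segment a b \<Longrightarrow> norm (F z) \<le> B"
  shows "norm (alg_contour_integral (linepath a b) F) \<le> B * cmod (b - a)"
proof -
  have "norm (alg_contour_integral (linepath a b) F) \<le> integral {0..1::real} (\<lambda>t. B * cmod (b - a))"
    unfolding alg_contour_integral_def
  proof (rule integral_norm_bound_integral)
    show "norm (vector_derivative (linepath a b) (at t within {0..1}) *\<^sub>C F (linepath a b t)) \<le> B * cmod (b - a)"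
      if "t \<in> {0..1}" for t :: real
      using that assms(2)[of "linepath a b t"]
      by (simp add: vector_derivative_linepath_within norm_scaleC linepath_in_path mult.commute[of B] mult_left_mono)
  qed (use assms(1) in \<open>auto simp: alg_contour_integrable_def intro: integrable_continuous_real\<close>)
  thus ?thesis by simp
qed

text \<open>The primitive is the integral along straight segments from a base point. That its
  increments are again segment integrals is Cauchy's theorem for triangles, which is tested with
  functionals.\<close>

lemma cdiff_on_convex_primitive:
  fixes F :: "complex \<Rightarrow> 'a::complex_banach_algebra"
  assumes S: "open S" "convex S" and F: "cdiff_on F S"
  obtains P where "\<And>z. z \<in> S \<Longrightarrow> (P has_derivative (\<lambda>h. h *\<^sub>C F z)) (at z)"
proof (cases "S = {}")
  case False
  then obtain a where a: "a \<in> S" by blast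
  have cont: "continuous_on S F" using F by (rule cdiff_on_continuous)
  have seg: "closed_segment u v \<subseteq> S" if "u \<in> S" "v \<in> S" for u v
    using that S(2) by (simp add: closed_segment_subset)
  have int: "alg_contour_integrable (linepath u v) F" if "u \<in> S" "v \<in> S" for u v
    by (rule alg_contour_integrable_linepath) (rule continuous_on_subset[OF cont seg[OF that]])
  define P where "P z = alg_contour_integral (linepath a z) F" for z
  have diff: "P w - P z = alg_contour_integral (linepath z w) F" if "z \<in> S" "w \<in> S" for z w
  proof (rule eq_of_cfunctionals)
    fix \<phi> :: "'a \<Rightarrow> complex" assume \<phi>: "cfunctional \<phi>"
    obtain q where q: "\<And>x. x \<in> S \<Longrightarrow> (q has_field_derivative \<phi> (F x)) (at x within S)"
      using holomorphic_convex_primitive'[OF S(2,1) cfunctional_cdiff_holomorphic[OF \<phi> F]] by blast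
    have *: "\<phi> (alg_contour_integral (linepath u v) F) = q v - q u" if "u \<in> S" "v \<in> S" for u v
      using has_contour_integral_unique[OF cfunctional_alg_contour_integral[OF \<phi> int[OF that]]
          contour_integral_primitive[OF q, of "linepath u v"]] seg[OF that] by simp
    interpret \<phi>: bounded_linear \<phi> using \<phi> by (simp add: cfunctional_def)
    show "\<phi> (P w - P z) = \<phi> (alg_contour_integral (linepath z w) F)"
      using that a by (simp add: P_def \<phi>.diff *)
  qed
  have "(P has_derivative (\<lambda>h. h *\<^sub>C F z)) (at z)" if z: "z \<in> S" for z
    unfolding has_derivative_at_alt
  proof (intro conjI allI impI)
    fix e :: real assume e: "e > 0"
    have "isCont F z" using cont S(1) z by (simp add: continuous_on_eq_continuous_at)
    then obtain d1 where d1: "d1 > 0" "\<And>w. dist w z < d1 \<Longrightarrow> dist (F w) (F z) < e"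
      using e unfolding continuous_at_eps_delta by blast
    obtain d2 where d2: "d2 > 0" "ball z d2 \<subseteq> S"
      using S(1) z open_contains_ball by blast
    have "norm (P w - P z - (w - z) *\<^sub>C F z) \<le> e * norm (w - z)" if w: "norm (w - z) < min d1 d2" for w
    proof -
      have wS: "w \<in> S" using w d2 by (auto simp: dist_norm norm_minus_commute)
      have ic: "alg_contour_integrable (linepath z w) (\<lambda>u. F z)"
        by (rule alg_contour_integrable_linepath) simp
      have "P w - P z - (w - z) *\<^sub>C F z = alg_contour_integral (linepath z w) (\<lambda>u. F u - F z)"
        by (simp add: diff z wS alg_contour_integral_diff int ic alg_contour_integral_linepath_const)
      also have "norm \<dots> \<le> e * cmod (w - z)"
      proof (rule norm_alg_contour_integral_linepath_le)
        show "alg_contour_integrable (linepath z w) (\<lambda>u. F u - F z)"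
          by (intro alg_contour_integrable_linepath continuous_intros continuous_on_subset[OF cont] seg z wS)
        fix u assume "u \<in> closed_segment z w"
        hence "norm (u - z) \<le> norm (w - z)" by (rule segment_bound1)
        thus "norm (F u - F z) \<le> e" using d1(2)[of u] w by (simp add: dist_norm)
      qed
      finally show ?thesis .
    qed
    thus "\<exists>d>0. \<forall>w. norm (w - z) < d \<longrightarrow> norm (P w - P z - (w - z) *\<^sub>C F z) \<le> e * norm (w - z)"
      using d1 d2 by (intro exI[of _ "min d1 d2"]) auto
  qed (rule bounded_linear_scaleC_left)
  thus ?thesis using that by blast
qed (use that in blast)

text \<open>The derivative of a piecewise \<open>C\<^sup>1\<close> path may be unbounded near a break point, so continuity of
  the integrand does not ensure integrability. Local primitives do: composed with the path
  they are continuous functions with the right derivative off a finite set, and the fundamental theorem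
  for the gauge integral asks for no more.\<close>

lemma alg_contour_integrable_cdiff:
  fixes F :: "complex \<Rightarrow> 'a::complex_banach_algebra"
  assumes S: "open S" and F: "cdiff_on F S" and g: "valid_path g" "path_image g \<subseteq> S"
  shows "alg_contour_integrable g F"
proof -
  obtain K where contg: "continuous_on {0..1} g" and K: "finite K" "g C1_differentiable_on ({0..1} - K)"
    using g(1) unfolding valid_path_def piecewise_C1_differentiable_on_def by auto
  have dg: "(g has_vector_derivative vector_derivative g (at t)) (at t)" if "t \<in> {0..1} - K" for t
    using K(2) that by (simp add: C1_differentiable_on_eq vector_derivative_works)
  have "(\<lambda>t. vector_derivative g (at t within {0..1}) *\<^sub>C F (g t)) integrable_on cbox 0 1"
  proof (rule integrable_on_little_subintervals, rule ballI)
    fix t0 :: real assume t0: "t0 \<in> cbox 0 1"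
    hence gt0: "g t0 \<in> S" using g(2) by (auto simp: path_image_def)
    then obtain r where r: "r > 0" "ball (g t0) r \<subseteq> S"
      using S open_contains_ball by blast
    obtain P where P: "\<And>z. z \<in> ball (g t0) r \<Longrightarrow> (P has_derivative (\<lambda>h. h *\<^sub>C F z)) (at z)"
      using cdiff_on_convex_primitive[OF open_ball convex_ball cdiff_on_subset[OF F r(2)]] by blast
    obtain d where d: "d > 0" "\<And>t. t \<in> {0..1} \<Longrightarrow> dist t t0 < d \<Longrightarrow> dist (g t) (g t0) < r"
      using contg t0 r(1) unfolding continuous_on_iff by (metis interval_cbox)
    have "(\<lambda>t. vector_derivative g (at t within {0..1}) *\<^sub>C F (g t)) integrable_on cbox u v"
      if uv: "t0 \<in> cbox u v" "cbox u v \<subseteq> ball t0 d" "cbox u v \<subseteq> cbox 0 1" for u v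
    proof -
      have "u \<le> v" using uv(1) by auto
      have near: "t \<in> {0..1}" "g t \<in> ball (g t0) r" if "t \<in> {u..v}" for t
        using uv that d(2)[of t] by (auto simp: dist_commute subset_iff)
      have "((\<lambda>t. vector_derivative g (at t) *\<^sub>C F (g t)) has_integral (P (g v) - P (g u))) {u..v}"
      proof (rule fundamental_theorem_of_calculus_interior_strong[OF K(1) \<open>u \<le> v\<close>, of "\<lambda>t. P (g t)"])
        fix t assume t: "t \<in> {u<..<v} - K"
        have "(g has_vector_derivative vector_derivative g (at t)) (at t)"
          using t near(1)[of t] by (intro dg) auto
        from diff_chain_at[OF this[unfolded has_vector_derivative_def] P[OF near(2), of t]] t
        show "((\<lambda>t. P (g t)) has_vector_derivative vector_derivative g (at t) *\<^sub>C F (g t)) (at t)"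
          by (simp add: has_vector_derivative_def o_def scaleR_scaleC scaleC_scaleC scaleR_conv_of_real)
      next
        have "continuous_on (ball (g t0) r) P"
          by (rule continuous_at_imp_continuous_on) (use P has_derivative_continuous in blast)
        thus "continuous_on {u..v} (\<lambda>t. P (g t))"
          by (rule continuous_on_compose2) (use near in \<open>auto intro: continuous_on_subset[OF contg]\<close>)
      qed
      hence int: "(\<lambda>t. vector_derivative g (at t) *\<^sub>C F (g t)) integrable_on {u..v}" by blast
      have eq: "vector_derivative g (at t within {0..1}) = vector_derivative g (at t)"
        if "t \<in> {u..v} - {0,1}" for t
        using near(1)[of t] that by (subst at_within_Icc_at) auto
      show ?thesis
        unfolding cbox_interval
        by (rule integrable_spike_finite[OF _ _ int, where S = "{0,1}"]) (simp_all only: eq finite.intros)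
    qed
    thus "\<exists>d>0. \<forall>u v. t0 \<in> cbox u v \<and> cbox u v \<subseteq> ball t0 d \<and> cbox u v \<subseteq> cbox 0 1 \<longrightarrow>
        (\<lambda>t. vector_derivative g (at t within {0..1}) *\<^sub>C F (g t)) integrable_on cbox u v"
      using d(1) by blast
  qed
  thus ?thesis by (simp add: alg_contour_integrable_def)
qed

lemma alg_Cauchy_convex:
  fixes F :: "complex \<Rightarrow> 'a::complex_banach_algebra"
  assumes "open S" "convex S" "cdiff_on F S" "valid_path g" "path_image g \<subseteq> S" "pathfinish g = pathstart g"
  shows "alg_contour_integral g F = 0"
proof (rule eq_of_cfunctionals)
  fix \<phi> :: "'a \<Rightarrow> complex" assume \<phi>: "cfunctional \<phi>"
  have "((\<lambda>z. \<phi> (F z)) has_contour_integral 0) g"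
    by (rule Cauchy_theorem_convex_simple[OF cfunctional_cdiff_holomorphic[OF \<phi> assms(3)]]) (use assms in auto)
  moreover have "((\<lambda>z. \<phi> (F z)) has_contour_integral \<phi> (alg_contour_integral g F)) g"
    using assms by (intro cfunctional_alg_contour_integral \<phi> alg_contour_integrable_cdiff[where S = S]) auto
  ultimately show "\<phi> (alg_contour_integral g F) = \<phi> 0"
    using has_contour_integral_unique \<phi>
    by (metis cfunctional_def linear_0 bounded_linear.linear)
qed

text \<open>Concentric circles are homotopic through the circles between them.\<close>

lemma alg_Cauchy_circles:
  fixes F :: "complex \<Rightarrow> 'a::complex_banach_algebra"
  assumes "open S" "cdiff_on F S" "0 < r" "r \<le> s" "cball c s - ball c r \<subseteq> S"
  shows "alg_contour_integral (circlepath c r) F = alg_contour_integral (circlepath c s) F"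
proof -
  have hom: "homotopic_loops S (circlepath c r) (circlepath c s)"
  proof (rule homotopic_loops_linear)
    fix t assume "t \<in> {0..1::real}"
    show "closed_segment (circlepath c r t) (circlepath c s t) \<subseteq> S"
    proof
      fix z assume "z \<in> closed_segment (circlepath c r t) (circlepath c s t)"
      then obtain u where u: "0 \<le> u" "u \<le> 1" "z = (1 - u) *\<^sub>R circlepath c r t + u *\<^sub>R circlepath c s t"
        unfolding closed_segment_def by auto
      define \<rho> where "\<rho> = (1 - u) * r + u * s"
      have \<rho>: "r \<le> \<rho>" "\<rho> \<le> s"
        using mult_nonneg_nonneg[of u "s - r"] mult_nonneg_nonneg[of "1 - u" "s - r"] u(1,2) assms(4)
        by (simp_all add: \<rho>_def algebra_simps)
      have "z = c + of_real \<rho> * exp (2 * of_real pi * \<i> * of_real t)"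
        using u(3) by (simp add: circlepath scaleR_conv_of_real \<rho>_def algebra_simps)
      hence "dist c z = \<rho>"
        using \<rho> assms(3) by (simp add: dist_norm norm_mult norm_exp_eq_Re)
      hence "z \<in> cball c s - ball c r" using \<rho> by simp
      thus "z \<in> S" using assms(5) by blast
    qed
  qed simp_all
  have "alg_contour_integrable (circlepath c q) F" if "r \<le> q" "q \<le> s" for q
    by (rule alg_contour_integrable_cdiff[OF assms(1,2)]) (use that assms in \<open>auto simp: path_image_circlepath\<close>)
  with assms show ?thesis
    by (intro alg_contour_integral_eqI
        Cauchy_theorem_homotopic_loops[OF hom assms(1) cfunctional_cdiff_holomorphic[OF _ assms(2)]]) auto
qed

section \<open>Functional calculus on circles\<close>

lemma norm_alg_contour_integral_circlepath_le:
  assumes "alg_contour_integrable (circlepath c r) F" "r > 0" "\<And>z. z \<in> sphere c r \<Longrightarrow> norm (F z) \<le> B"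
  shows "norm (alg_contour_integral (circlepath c r) F) \<le> 2 * pi * r * B"
proof -
  have "norm (alg_contour_integral (circlepath c r) F) \<le> integral {0..1::real} (\<lambda>t. 2 * pi * r * B)"
    unfolding alg_contour_integral_def
  proof (rule integral_norm_bound_integral)
    show "norm (vector_derivative (circlepath c r) (at t within {0..1}) *\<^sub>C F (circlepath c r t)) \<le> 2 * pi * r * B"
      if "t \<in> {0..1}" for t :: real
    proof -
      have "circlepath c r t \<in> sphere c r"
        using that assms(2) path_image_circlepath[of c r] by (auto simp: path_image_def)
      hence "norm (F (circlepath c r t)) \<le> B" by (rule assms(3))
      moreover have "cmod (vector_derivative (circlepath c r) (at t within {0..1})) = 2 * pi * r"
        using that assms(2) by (simp add: vector_derivative_circlepath01 norm_mult norm_exp_eq_Re)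
      ultimately show ?thesis
        using assms(2) by (simp add: norm_scaleC mult_left_mono)
    qed
  qed (use assms(1) in \<open>auto simp: alg_contour_integrable_def intro: integrable_continuous_real\<close>)
  thus ?thesis by simp
qed

lemma cdiff_on_holomorphic_resolvent:
  assumes "f holomorphic_on S" "open S"
  shows "cdiff_on (\<lambda>z. f z *\<^sub>C resolvent a z) (S - spectrum a)"
  by (intro cdiff_on_scaleC holomorphic_on_subset[OF assms(1)] open_Diff assms(2) closed_spectrum
      cdiff_on_subset[OF cdiff_on_resolvent]) auto

lemma alg_contour_integrable_resolvent:
  assumes "f holomorphic_on S" "open S" "valid_path g" "path_image g \<subseteq> S - spectrum a"
  shows "alg_contour_integrable g (\<lambda>z. f z *\<^sub>C resolvent a z)"
  by (rule alg_contour_integrable_cdiff[OF _ cdiff_on_holomorphic_resolvent[OF assms(1,2)]])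
    (use assms in \<open>auto intro: open_Diff closed_spectrum\<close>)

text \<open>The integral does not change when the circle grows to radius \<open>s\<close>, and there
  \<open>R(z) - 1/(z - c) = (a - c) R(z) / (z - c)\<close> is of order \<open>1/s\<^sup>2\<close>; so the integral agrees with that of
  \<open>1/(z - c)\<close>. In particular the unit is recovered from the resolvent, without a power series for it.\<close>

lemma alg_contour_integral_resolvent:
  fixes a :: "'a::complex_banach_algebra"
  assumes r: "r > 0" and sp: "spectrum a \<subseteq> ball c r"
  shows "alg_contour_integral (circlepath c r) (resolvent a) = (2 * of_real pi * \<i>) *\<^sub>C 1"
proof (rule eq_of_cfunctionals)
  fix \<phi> :: "'a \<Rightarrow> complex" assume \<phi>: "cfunctional \<phi>"
  hence bl: "bounded_linear \<phi>" and lin: "\<And>c x. \<phi> (c *\<^sub>C x) = c * \<phi> x"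
    by (auto simp: cfunctional_def)
  interpret \<phi>: bounded_linear \<phi> by (rule bl)
  obtain K where K: "K \<ge> 0" "\<And>x. norm (\<phi> x) \<le> norm x * K"
    using \<phi>.nonneg_bounded by blast
  define J where "J = alg_contour_integral (circlepath c r) (resolvent a)"
  define D where "D = cmod c + norm a"
  define C where "C = 2 * pi * (norm (a - c *\<^sub>C 1) * norm (1::'a) * K)"
  have C0: "C \<ge> 0" using K by (simp add: C_def)
  \<comment> \<open>The length \<open>2 \<pi> s\<close> of the circle cancels one of the two factors \<open>1/s\<close> of decay.\<close>
  have bound: "norm (\<phi> J - 2 * of_real pi * \<i> * \<phi> 1) \<le> C / (s - D)" if s: "s \<ge> r" "s > D" for s
  proof -
    have s0: "s > 0" using s r by simp
    have "J = alg_contour_integral (circlepath c s) (resolvent a)"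
      unfolding J_def
      by (rule alg_Cauchy_circles[OF _ cdiff_on_resolvent r s(1)])
        (use sp closed_spectrum[of a] in \<open>auto simp: open_Compl\<close>)
    moreover have "alg_contour_integrable (circlepath c s) (resolvent a)"
      by (rule alg_contour_integrable_cdiff[OF _ cdiff_on_resolvent])
        (use sp s s0 closed_spectrum[of a] in \<open>auto simp: open_Compl\<close>)
    ultimately have "((\<lambda>z. \<phi> (resolvent a z)) has_contour_integral \<phi> J) (circlepath c s)"
      using cfunctional_alg_contour_integral[OF \<phi>] by simp
    moreover have "((\<lambda>z. \<phi> 1 / (z - c)) has_contour_integral (2 * of_real pi * \<i> * \<phi> 1)) (circlepath c s)"
      using Cauchy_integral_circlepath_simple[of "\<lambda>z. \<phi> 1" c s c] s0 by simp
    ultimately have int: "((\<lambda>z. \<phi> (resolvent a z) - \<phi> 1 / (z - c)) has_contour_integral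
        (\<phi> J - 2 * of_real pi * \<i> * \<phi> 1)) (circlepath c s)"
      by (rule has_contour_integral_diff)
    define B where "B = norm (a - c *\<^sub>C 1) * norm (1::'a) * K / (s * (s - D))"
    have "norm (\<phi> J - 2 * of_real pi * \<i> * \<phi> 1) \<le> B * (2 * pi * s)"
    proof (rule has_contour_integral_bound_circlepath[OF int])
      show "B \<ge> 0" using s s0 K by (simp add: B_def)
      fix z assume z: "cmod (z - c) = s"
      have zc: "z \<noteq> c" using z s0 by auto
      have "cmod z \<ge> s - cmod c" using z norm_triangle_ineq2[of "z - c" "- c"] by simp
      hence za: "cmod z - norm a \<ge> s - D" by (simp add: D_def)
      have nz: "z \<notin> spectrum a" using sp z s by (auto simp: dist_norm norm_minus_commute)
      have Rn: "norm (resolvent a z) \<le> norm (1::'a) / (s - D)"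
        using norm_resolvent_le[of a z] za s(2) by (smt (verit) frac_le norm_ge_zero)
      have "(z - c) *\<^sub>C resolvent a z = 1 + (a - c *\<^sub>C 1) * resolvent a z"
        using scaleC_resolvent[OF nz] by (simp add: scaleC_diff_left left_diff_distrib mult_scaleC_left)
      hence "\<phi> ((z - c) *\<^sub>C resolvent a z) = \<phi> 1 + \<phi> ((a - c *\<^sub>C 1) * resolvent a z)"
        by (simp add: \<phi>.add)
      hence "\<phi> (resolvent a z) - \<phi> 1 / (z - c) = \<phi> ((a - c *\<^sub>C 1) * resolvent a z) / (z - c)"
        using zc by (simp add: lin field_simps)
      hence "norm (\<phi> (resolvent a z) - \<phi> 1 / (z - c)) = norm (\<phi> ((a - c *\<^sub>C 1) * resolvent a z)) / s"
        by (simp add: norm_divide z)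
      also have "\<dots> \<le> norm ((a - c *\<^sub>C 1) * resolvent a z) * K / s"
        using K(2) s0 by (simp add: divide_right_mono)
      also have "\<dots> \<le> (norm (a - c *\<^sub>C 1) * (norm (1::'a) / (s - D))) * K / s"
        using s0 K(1) Rn
        by (intro divide_right_mono mult_right_mono order_trans[OF norm_mult_ineq] mult_left_mono) auto
      also have "\<dots> = B" by (simp add: B_def)
      finally show "norm (\<phi> (resolvent a z) - \<phi> 1 / (z - c)) \<le> B" .
    qed (rule s0)
    also have "B * (2 * pi * s) = C / (s - D)"
      using s0 by (simp add: B_def C_def)
    finally show ?thesis .
  qed
  have "norm (\<phi> J - 2 * of_real pi * \<i> * \<phi> 1) \<le> 0"
  proof (rule tendsto_lowerbound)
    have "filterlim (\<lambda>s. s - D) at_top at_top"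
      using filterlim_tendsto_add_at_top[OF tendsto_const[of "- D"] filterlim_ident] by simp
    thus "((\<lambda>s. C / (s - D)) \<longlongrightarrow> 0) at_top"
      by (intro real_tendsto_divide_at_top[OF tendsto_const])
    show "\<forall>\<^sub>F s in at_top. norm (\<phi> J - 2 * of_real pi * \<i> * \<phi> 1) \<le> C / (s - D)"
      using eventually_ge_at_top[of r] eventually_gt_at_top[of D] by eventually_elim (rule bound)
  qed simp
  thus "\<phi> (alg_contour_integral (circlepath c r) (resolvent a)) = \<phi> ((2 * of_real pi * \<i>) *\<^sub>C 1)"
    by (simp add: J_def lin)
qed

definition circle_calc :: "complex \<Rightarrow> real \<Rightarrow> (complex \<Rightarrow> complex) \<Rightarrow> 'a::complex_banach_algebra \<Rightarrow> 'a" where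
  "circle_calc c r f a =
     (1 / (2 * of_real pi * \<i>)) *\<^sub>C alg_contour_integral (circlepath c r) (\<lambda>z. f z *\<^sub>C resolvent a z)"

text \<open>The data under which the calculus on the circle is used: functions are holomorphic on the
  convex open set \<open>S\<close>, which contains the closed disc, and the open disc contains the spectrum.\<close>

definition calc_disc :: "'a::complex_banach_algebra \<Rightarrow> complex set \<Rightarrow> complex \<Rightarrow> real \<Rightarrow> bool" where
  "calc_disc a S c r \<longleftrightarrow> open S \<and> convex S \<and> 0 < r \<and> cball c r \<subseteq> S \<and> spectrum a \<subseteq> ball c r"

lemma calc_disc_integrable:
  assumes "calc_disc a S c r" "f holomorphic_on S"
  shows "alg_contour_integrable (circlepath c r) (\<lambda>z. f z *\<^sub>C resolvent a z)"
  by (rule alg_contour_integrable_resolvent[OF assms(2)])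
    (use assms(1) in \<open>auto simp: calc_disc_def subset_iff\<close>)

lemma circle_calc_cong:
  assumes "calc_disc a S c r" "\<And>z. z \<in> S \<Longrightarrow> f z = g z"
  shows "circle_calc c r f a = circle_calc c r g a"
  unfolding circle_calc_def
  by (intro arg_cong[where f = "scaleC _"] alg_contour_integral_cong)
    (use assms in \<open>auto simp: calc_disc_def subset_iff\<close>)

lemma circle_calc_one:
  assumes "calc_disc a S c r"
  shows "circle_calc c r (\<lambda>z. 1) a = 1"
  using alg_contour_integral_resolvent[of r a c] assms
  by (simp add: circle_calc_def calc_disc_def scaleC_scaleC)

lemma circle_calc_add:
  assumes "calc_disc a S c r" "f holomorphic_on S" "g holomorphic_on S"
  shows "circle_calc c r (\<lambda>z. f z + g z) a = circle_calc c r f a + circle_calc c r g a"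
  using alg_contour_integral_add[OF calc_disc_integrable[OF assms(1,2)] calc_disc_integrable[OF assms(1,3)]]
  by (simp add: circle_calc_def scaleC_add_left scaleC_add_right)

lemma circle_calc_scaleC:
  assumes "calc_disc a S c r" "f holomorphic_on S"
  shows "circle_calc c r (\<lambda>z. k * f z) a = k *\<^sub>C circle_calc c r f a"
  using alg_contour_integral_linear[OF bounded_linear_scaleC_right[of k] _ calc_disc_integrable[OF assms]]
  by (simp add: circle_calc_def scaleC_scaleC mult.commute[of k])

lemma alg_contour_integral_mult_left:
  assumes "alg_contour_integrable g f"
  shows "alg_contour_integral g (\<lambda>z. x * f z) = x * alg_contour_integral g f"
  by (rule alg_contour_integral_linear[OF bounded_linear_mult_right _ assms]) (simp add: mult_scaleC_right)

lemma alg_contour_integral_mult_right: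
  assumes "alg_contour_integrable g f"
  shows "alg_contour_integral g (\<lambda>z. f z * x) = alg_contour_integral g f * x"
  by (rule alg_contour_integral_linear[OF bounded_linear_mult_left _ assms]) (simp add: mult_scaleC_left)

text \<open>Since \<open>z R(z) = 1 + a R(z)\<close>, multiplication of \<open>f\<close> by \<open>z\<close> multiplies the integral by \<open>a\<close>, up to the
  integral of the holomorphic function \<open>f\<close> over a closed curve.\<close>

lemma circle_calc_times_id:
  assumes disc: "calc_disc a S c r" and f: "f holomorphic_on S"
  shows "circle_calc c r (\<lambda>z. z * f z) a = a * circle_calc c r f a"
proof -
  have S: "open S" "convex S" "0 < r" "cball c r \<subseteq> S" "spectrum a \<subseteq> ball c r"
    using disc by (auto simp: calc_disc_def)
  have sph: "sphere c r \<subseteq> S" using S(4) by auto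
  have c1: "cdiff_on (\<lambda>z. f z *\<^sub>C (1::'a)) S"
    by (rule cdiff_on_scaleC[OF f S(1) cdiff_on_const])
  have i1: "alg_contour_integrable (circlepath c r) (\<lambda>z. f z *\<^sub>C (1::'a))"
    by (rule alg_contour_integrable_cdiff[OF S(1) c1]) (use S(3) sph in auto)
  have i2: "alg_contour_integrable (circlepath c r) (\<lambda>z. a * f z *\<^sub>C resolvent a z)"
    by (rule alg_contour_integrable_linear[OF bounded_linear_mult_right _ calc_disc_integrable[OF disc f]])
      (simp add: mult_scaleC_right)
  have "alg_contour_integral (circlepath c r) (\<lambda>z. (z * f z) *\<^sub>C resolvent a z)
      = alg_contour_integral (circlepath c r) (\<lambda>z. f z *\<^sub>C 1 + a * f z *\<^sub>C resolvent a z)"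
  proof (rule alg_contour_integral_cong)
    fix z assume "z \<in> path_image (circlepath c r)"
    hence "z \<notin> spectrum a" using S by auto
    from scaleC_resolvent[OF this] have "f z *\<^sub>C z *\<^sub>C resolvent a z = f z *\<^sub>C (1 + a * resolvent a z)"
      by simp
    thus "(z * f z) *\<^sub>C resolvent a z = f z *\<^sub>C 1 + a * f z *\<^sub>C resolvent a z"
      by (simp add: scaleC_simps mult.commute)
  qed
  also have "\<dots> = alg_contour_integral (circlepath c r) (\<lambda>z. f z *\<^sub>C 1)
      + alg_contour_integral (circlepath c r) (\<lambda>z. a * f z *\<^sub>C resolvent a z)"
    by (rule alg_contour_integral_add[OF i1 i2])
  also have "alg_contour_integral (circlepath c r) (\<lambda>z. f z *\<^sub>C (1::'a)) = 0"
    by (rule alg_Cauchy_convex[OF S(1,2) c1]) (use S(3) sph in auto)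
  also have "alg_contour_integral (circlepath c r) (\<lambda>z. a * f z *\<^sub>C resolvent a z)
      = a * alg_contour_integral (circlepath c r) (\<lambda>z. f z *\<^sub>C resolvent a z)"
    by (rule alg_contour_integral_mult_left[OF calc_disc_integrable[OF disc f]])
  finally show ?thesis by (simp add: circle_calc_def mult_scaleC_right)
qed

lemma circle_calc_commute:
  assumes disc: "calc_disc a S c r" and f: "f holomorphic_on S" and comm: "a * x = x * a"
  shows "circle_calc c r f a * x = x * circle_calc c r f a"
proof -
  note int = calc_disc_integrable[OF disc f]
  have "alg_contour_integral (circlepath c r) (\<lambda>z. f z *\<^sub>C resolvent a z * x)
      = alg_contour_integral (circlepath c r) (\<lambda>z. x * f z *\<^sub>C resolvent a z)"
  proof (rule alg_contour_integral_cong)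
    fix z assume "z \<in> path_image (circlepath c r)"
    hence "z *\<^sub>C 1 - a \<in> Inv" using disc by (auto simp: calc_disc_def subset_iff spectrum_def)
    moreover have "(z *\<^sub>C 1 - a) * x = x * (z *\<^sub>C 1 - a)"
      by (simp add: left_diff_distrib right_diff_distrib mult_scaleC_left mult_scaleC_right comm)
    ultimately have "resolvent a z * x = x * resolvent a z"
      unfolding resolvent_def by (rule alg_inv_commute)
    thus "f z *\<^sub>C resolvent a z * x = x * f z *\<^sub>C resolvent a z"
      by (simp add: mult_scaleC_left mult_scaleC_right)
  qed
  hence "alg_contour_integral (circlepath c r) (\<lambda>z. f z *\<^sub>C resolvent a z) * x
      = x * alg_contour_integral (circlepath c r) (\<lambda>z. f z *\<^sub>C resolvent a z)"
    by (simp only: alg_contour_integral_mult_left[OF int] alg_contour_integral_mult_right[OF int])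
  thus ?thesis
    by (simp add: circle_calc_def mult_scaleC_left mult_scaleC_right)
qed

lemma smaller_disc:
  assumes "compact K" "K \<subseteq> ball c r" "0 < r"
  obtains s where "0 < s" "s < r" "K \<subseteq> ball c s"
proof (cases "K = {}")
  case True
  with assms(3) show ?thesis by (intro that[of "r / 2"]) auto
next
  case False
  obtain x where x: "x \<in> K" "\<And>y. y \<in> K \<Longrightarrow> dist c y \<le> dist c x"
    using continuous_attains_sup[OF assms(1) False, of "dist c"] continuous_on_dist[OF continuous_on_const continuous_on_id]
    by metis
  have "dist c x < r" using x(1) assms(2) by auto
  thus ?thesis
    using x(2) assms(3) by (intro that[of "(dist c x + r) / 2"]) (auto simp: add_nonneg_pos, force)
qed

lemma circle_calc_shrink:
  assumes disc: "calc_disc a S c r" and f: "f holomorphic_on S"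
    and s: "0 < s" "s < r" "spectrum a \<subseteq> ball c s"
  shows "circle_calc c s f a = circle_calc c r f a"
proof -
  have S: "open S" "cball c r \<subseteq> S" using disc by (auto simp: calc_disc_def)
  have "alg_contour_integral (circlepath c s) (\<lambda>z. f z *\<^sub>C resolvent a z)
      = alg_contour_integral (circlepath c r) (\<lambda>z. f z *\<^sub>C resolvent a z)"
    by (rule alg_Cauchy_circles[OF open_Diff[OF S(1) closed_spectrum] cdiff_on_holomorphic_resolvent[OF f S(1)]])
      (use S s in auto)
  thus ?thesis by (simp only: circle_calc_def)
qed

text \<open>Multiplicativity needs two different circles, so that \<open>z\<close> on the inner one and \<open>w\<close> on the outer
  one never meet. By the resolvent identity \<open>R(z) R(w) = (R(z) - R(w)) / (w - z)\<close>. The term with \<open>R(w)\<close>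
  vanishes on integration over \<open>z\<close>, because \<open>f(z)/(w - z)\<close> is holomorphic inside the outer circle. In the term
  with \<open>R(z)\<close> the integrals are exchanged, and Cauchy's formula evaluates the integral of
  \<open>g(w)/(w - z)\<close>. The exchange is a statement about scalar integrals and is therefore made after
  applying a functional.\<close>

lemma circle_calc_mult:
  fixes a :: "'a::complex_banach_algebra"
  assumes disc: "calc_disc a S c r" and f: "f holomorphic_on S" and g: "g holomorphic_on S"
  shows "circle_calc c r f a * circle_calc c r g a = circle_calc c r (\<lambda>z. f z * g z) a"
proof -
  have S: "open S" "convex S" "0 < r" "cball c r \<subseteq> S" "spectrum a \<subseteq> ball c r"
    using disc by (auto simp: calc_disc_def)
  obtain s where s: "0 < s" "s < r" "spectrum a \<subseteq> ball c s"
    using smaller_disc[OF compact_spectrum S(5,3)] .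
  have disc': "calc_disc a S c s"
    using S s by (auto simp: calc_disc_def)
  define R where "R = resolvent a"
  define J where "J = alg_contour_integral (circlepath c s) (\<lambda>z. f z *\<^sub>C R z)"
  define L where "L = alg_contour_integral (circlepath c r) (\<lambda>z. g z *\<^sub>C R z)"
  define M where "M = alg_contour_integral (circlepath c s) (\<lambda>z. (f z * g z) *\<^sub>C R z)"
  have fg: "(\<lambda>z. f z * g z) holomorphic_on S" using f g by (intro holomorphic_intros)
  have iJ: "alg_contour_integrable (circlepath c s) (\<lambda>z. f z *\<^sub>C R z)"
    and iL: "alg_contour_integrable (circlepath c r) (\<lambda>z. g z *\<^sub>C R z)"
    and iM: "alg_contour_integrable (circlepath c s) (\<lambda>z. (f z * g z) *\<^sub>C R z)"
    unfolding R_def using calc_disc_integrable disc disc' f g fg by blast+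
  have JR: "J * R w = alg_contour_integral (circlepath c s) (\<lambda>z. (f z / (w - z)) *\<^sub>C R z)"
      "alg_contour_integrable (circlepath c s) (\<lambda>z. (f z / (w - z)) *\<^sub>C R z)"
    if w: "w \<in> sphere c r" for w
  proof -
    have wn: "w \<notin> spectrum a" using w S by auto
    have holq: "(\<lambda>z. f z / (w - z)) holomorphic_on ball c r"
      using w S(4) by (intro holomorphic_intros holomorphic_on_subset[OF f]) auto
    have disc'': "calc_disc a (ball c r) c s" using s by (auto simp: calc_disc_def)
    show i1: "alg_contour_integrable (circlepath c s) (\<lambda>z. (f z / (w - z)) *\<^sub>C R z)"
      unfolding R_def by (rule calc_disc_integrable[OF disc'' holq])
    have c2: "cdiff_on (\<lambda>z. (f z / (w - z)) *\<^sub>C R w) (ball c r)"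
      by (rule cdiff_on_scaleC[OF holq open_ball cdiff_on_const])
    have i2: "alg_contour_integrable (circlepath c s) (\<lambda>z. (f z / (w - z)) *\<^sub>C R w)"
      by (rule alg_contour_integrable_cdiff[OF open_ball c2]) (use s in auto)
    have "J * R w = alg_contour_integral (circlepath c s) (\<lambda>z. f z *\<^sub>C R z * R w)"
      unfolding J_def by (simp only: alg_contour_integral_mult_right[OF iJ])
    also have "\<dots> = alg_contour_integral (circlepath c s)
        (\<lambda>z. (f z / (w - z)) *\<^sub>C R z - (f z / (w - z)) *\<^sub>C R w)"
    proof (rule alg_contour_integral_cong)
      fix z assume "z \<in> path_image (circlepath c s)"
      hence z: "z \<in> sphere c s" using s(1) by simp
      hence zn: "z \<notin> spectrum a" using s by auto
      have "w \<noteq> z" using z w s by auto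
      thus "f z *\<^sub>C R z * R w = (f z / (w - z)) *\<^sub>C R z - (f z / (w - z)) *\<^sub>C R w"
        unfolding R_def scaleC_diff_right[symmetric] resolvent_identity[OF zn wn]
        by (simp add: scaleC_scaleC mult_scaleC_left)
    qed
    also have "\<dots> = alg_contour_integral (circlepath c s) (\<lambda>z. (f z / (w - z)) *\<^sub>C R z)
        - alg_contour_integral (circlepath c s) (\<lambda>z. (f z / (w - z)) *\<^sub>C R w)"
      by (rule alg_contour_integral_diff[OF i1 i2])
    also have "alg_contour_integral (circlepath c s) (\<lambda>z. (f z / (w - z)) *\<^sub>C R w) = 0"
      by (rule alg_Cauchy_convex[OF open_ball convex_ball c2]) (use s in auto)
    finally show "J * R w = alg_contour_integral (circlepath c s) (\<lambda>z. (f z / (w - z)) *\<^sub>C R z)" by simp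
  qed
  have "J * L = (2 * of_real pi * \<i>) *\<^sub>C M"
  proof (rule eq_of_cfunctionals)
    fix \<phi> :: "'a \<Rightarrow> complex" assume \<phi>: "cfunctional \<phi>"
    hence bl: "bounded_linear \<phi>" and lin: "\<And>c x. \<phi> (c *\<^sub>C x) = c * \<phi> x"
      by (auto simp: cfunctional_def)
    have holR: "(\<lambda>z. \<phi> (R z)) holomorphic_on - spectrum a"
      unfolding R_def by (rule cfunctional_cdiff_holomorphic[OF \<phi> cdiff_on_resolvent])
    have sph: "sphere c s \<subseteq> S" "sphere c r \<subseteq> S" using S s by auto
    have "((\<lambda>w. \<phi> (J * g w *\<^sub>C R w)) has_contour_integral \<phi> (J * L)) (circlepath c r)"
      unfolding L_def alg_contour_integral_mult_left[OF iL, symmetric]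
      by (intro cfunctional_alg_contour_integral[OF \<phi>]
          alg_contour_integrable_linear[OF bounded_linear_mult_right _ iL]) (simp add: mult_scaleC_right)
    hence "\<phi> (J * L) = contour_integral (circlepath c r) (\<lambda>w. \<phi> (J * g w *\<^sub>C R w))"
      by (simp add: contour_integral_unique)
    also have "\<dots> = contour_integral (circlepath c r)
        (\<lambda>w. contour_integral (circlepath c s) (\<lambda>z. g w * (f z / (w - z) * \<phi> (R z))))"
    proof (rule contour_integral_cong)
      fix w assume "w \<in> path_image (circlepath c r)"
      hence w: "w \<in> sphere c r" using S by simp
      have "((\<lambda>z. \<phi> ((f z / (w - z)) *\<^sub>C R z)) has_contour_integral \<phi> (J * R w)) (circlepath c s)"
        using cfunctional_alg_contour_integral[OF \<phi> JR(2)[OF w]] JR(1)[OF w] by simp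
      hence "((\<lambda>z. g w * \<phi> ((f z / (w - z)) *\<^sub>C R z)) has_contour_integral g w * \<phi> (J * R w)) (circlepath c s)"
        by (rule has_contour_integral_lmul)
      thus "\<phi> (J * g w *\<^sub>C R w) = contour_integral (circlepath c s) (\<lambda>z. g w * (f z / (w - z) * \<phi> (R z)))"
        by (simp add: lin mult_scaleC_right contour_integral_unique)
    qed simp
    also have "\<dots> = contour_integral (circlepath c s)
        (\<lambda>z. contour_integral (circlepath c r) (\<lambda>w. g w * (f z / (w - z) * \<phi> (R z))))"
    proof (rule contour_integral_swap)
      have cf: "continuous_on (sphere c s) f" "continuous_on (sphere c r) g"
        using f g sph by (auto intro: continuous_on_subset holomorphic_on_imp_continuous_on)
      have cR: "continuous_on (sphere c s) (\<lambda>z. \<phi> (R z))"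
        by (rule continuous_on_subset[OF holomorphic_on_imp_continuous_on[OF holR]]) (use s in auto)
      show "continuous_on (path_image (circlepath c r) \<times> path_image (circlepath c s))
          (\<lambda>(w, z). g w * (f z / (w - z) * \<phi> (R z)))"
        unfolding case_prod_unfold
        by (intro continuous_intros continuous_on_compose2[OF cf(1)] continuous_on_compose2[OF cf(2)]
            continuous_on_compose2[OF cR]) (use s S in auto)
    qed (auto simp: vector_derivative_circlepath intro!: continuous_intros)
    also have "\<dots> = contour_integral (circlepath c s)
        (\<lambda>z. (2 * of_real pi * \<i>) * \<phi> ((f z * g z) *\<^sub>C R z))"
    proof (rule contour_integral_cong)
      fix z assume "z \<in> path_image (circlepath c s)"
      hence z: "z \<in> sphere c s" using s by simp
      have "((\<lambda>w. (g w * (f z * \<phi> (R z))) / (w - z)) has_contour_integral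
          2 * of_real pi * \<i> * (g z * (f z * \<phi> (R z)))) (circlepath c r)"
        by (rule Cauchy_integral_circlepath_simple)
          (use z s S(4) g in \<open>auto intro!: holomorphic_intros intro: holomorphic_on_subset
            simp: dist_norm norm_minus_commute\<close>)
      thus "contour_integral (circlepath c r) (\<lambda>w. g w * (f z / (w - z) * \<phi> (R z)))
          = (2 * of_real pi * \<i>) * \<phi> ((f z * g z) *\<^sub>C R z)"
        by (simp add: lin contour_integral_unique mult_ac)
    qed simp
    also have "\<dots> = (2 * of_real pi * \<i>) * \<phi> M"
      using has_contour_integral_lmul[OF cfunctional_alg_contour_integral[OF \<phi> iM], of "2 * of_real pi * \<i>"]
      by (simp add: contour_integral_unique M_def)
    also have "\<dots> = \<phi> ((2 * of_real pi * \<i>) *\<^sub>C M)" by (simp add: lin)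
    finally show "\<phi> (J * L) = \<phi> ((2 * of_real pi * \<i>) *\<^sub>C M)" .
  qed
  hence "circle_calc c s f a * circle_calc c r g a = circle_calc c s (\<lambda>z. f z * g z) a"
    by (simp add: circle_calc_def scaleC_scaleC mult_scaleC_left mult_scaleC_right J_def L_def M_def R_def)
  thus ?thesis
    by (simp add: circle_calc_shrink[OF disc _ s] f fg)
qed

lemma circle_calc_power:
  assumes "calc_disc a S c r"
  shows "circle_calc c r (\<lambda>z. z ^ n) a = a ^ n"
proof (induction n)
  case (Suc n)
  have "(\<lambda>z. z ^ n) holomorphic_on S" by (intro holomorphic_intros)
  from circle_calc_times_id[OF assms this] Suc show ?case by simp
qed (simp add: circle_calc_one[OF assms])

text \<open>The upper half of the spectral radius formula: estimate the integral of \<open>z\<^sup>n R(z)\<close> over the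
  circle of radius \<open>\<rho>\<close>.\<close>

lemma norm_power_le_of_spectrum:
  fixes a :: "'a::complex_banach_algebra"
  assumes "spectrum a \<subseteq> ball 0 \<rho>" "\<rho> > 0"
  obtains C where "C > 0" "\<And>n. norm (a ^ n) \<le> C * \<rho> ^ n"
proof -
  have disc: "calc_disc a UNIV 0 \<rho>" using assms by (simp add: calc_disc_def)
  have "continuous_on (sphere 0 \<rho>) (resolvent a)"
    by (rule continuous_on_subset[OF cdiff_on_continuous[OF cdiff_on_resolvent]]) (use assms in auto)
  hence "bounded (resolvent a ` sphere 0 \<rho>)"
    by (intro compact_imp_bounded compact_continuous_image) auto
  then obtain B where B: "B > 0" "\<And>z. z \<in> sphere 0 \<rho> \<Longrightarrow> norm (resolvent a z) \<le> B"
    unfolding bounded_pos by blast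
  have "norm (a ^ n) \<le> (\<rho> * B) * \<rho> ^ n" for n
  proof -
    have hol: "(\<lambda>z. z ^ n) holomorphic_on UNIV" by (intro holomorphic_intros)
    have "norm (alg_contour_integral (circlepath 0 \<rho>) (\<lambda>z. z ^ n *\<^sub>C resolvent a z)) \<le> 2 * pi * \<rho> * (\<rho> ^ n * B)"
      by (rule norm_alg_contour_integral_circlepath_le[OF calc_disc_integrable[OF disc hol] assms(2)])
        (use B assms(2) in \<open>auto simp: norm_scaleC norm_power intro!: mult_left_mono\<close>)
    hence "norm (circle_calc 0 \<rho> (\<lambda>z. z ^ n) a) \<le> (1 / (2 * pi)) * (2 * pi * \<rho> * (\<rho> ^ n * B))"
      unfolding circle_calc_def norm_scaleC
      by (simp add: norm_mult norm_divide divide_right_mono field_simps)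
    thus ?thesis by (simp add: circle_calc_power[OF disc] mult_ac)
  qed
  moreover have "\<rho> * B > 0" using assms B by simp
  ultimately show ?thesis using that by blast
qed

section \<open>Spectral mapping, similarity and sums\<close>

lemma circle_calc_id:
  assumes "calc_disc a S c r"
  shows "circle_calc c r (\<lambda>z. z) a = a"
  using circle_calc_power[OF assms, of 1] by simp

text \<open>If \<open>\<zeta>\<close> is not a value of \<open>f\<close>, the calculus applied to \<open>1 / (\<zeta> - f)\<close> produces the inverse of
  \<open>\<zeta> - f(a)\<close>.\<close>

lemma spectrum_circle_calc:
  assumes disc: "calc_disc a S c r" and f: "f holomorphic_on S"
  shows "spectrum (circle_calc c r f a) \<subseteq> f ` S"
proof
  fix \<zeta> assume \<zeta>: "\<zeta> \<in> spectrum (circle_calc c r f a)"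
  show "\<zeta> \<in> f ` S"
  proof (rule ccontr)
    assume "\<zeta> \<notin> f ` S"
    hence ne: "\<zeta> - f z \<noteq> 0" if "z \<in> S" for z using that by auto
    have h1: "(\<lambda>z. \<zeta> * 1 + (-1) * f z) holomorphic_on S" using f by (intro holomorphic_intros)
    have h2: "(\<lambda>z. 1 / (\<zeta> - f z)) holomorphic_on S" using f ne by (intro holomorphic_intros) auto
    have hf: "(\<lambda>z. \<zeta> * 1) holomorphic_on S" "(\<lambda>z. (-1) * f z) holomorphic_on S" "(\<lambda>z. 1) holomorphic_on S"
      using f by (auto intro!: holomorphic_intros)
    define p where "p = circle_calc c r (\<lambda>z. \<zeta> * 1 + (-1) * f z) a"
    define q where "q = circle_calc c r (\<lambda>z. 1 / (\<zeta> - f z)) a"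
    have "p * q = circle_calc c r (\<lambda>z. 1) a" "q * p = circle_calc c r (\<lambda>z. 1) a"
      unfolding p_def q_def circle_calc_mult[OF disc h1 h2] circle_calc_mult[OF disc h2 h1]
      by (rule circle_calc_cong[OF disc], use ne in simp)+
    hence "p \<in> Inv" by (intro InvI[of _ q]) (simp_all add: circle_calc_one[OF disc])
    moreover have "p = \<zeta> *\<^sub>C 1 - circle_calc c r f a"
      unfolding p_def circle_calc_add[OF disc hf(1,2)] circle_calc_scaleC[OF disc hf(3)]
        circle_calc_scaleC[OF disc f] circle_calc_one[OF disc] by simp
    ultimately show False using \<zeta> by (simp add: spectrum_iff)
  qed
qed

lemma circle_calc_similar:
  assumes u: "u \<in> Inv" and disc: "calc_disc a S c r" and f: "f holomorphic_on S"
  shows "circle_calc c r f (u * a * alg_inv u) = u * circle_calc c r f a * alg_inv u"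
proof -
  have bl: "bounded_linear (\<lambda>v. u * v * alg_inv u)"
    by (rule bounded_linear_compose[OF bounded_linear_mult_left bounded_linear_mult_right])
  have "alg_contour_integral (circlepath c r) (\<lambda>z. f z *\<^sub>C resolvent (u * a * alg_inv u) z)
      = alg_contour_integral (circlepath c r) (\<lambda>z. u * (f z *\<^sub>C resolvent a z) * alg_inv u)"
  proof (rule alg_contour_integral_cong)
    fix z assume "z \<in> path_image (circlepath c r)"
    hence z: "z *\<^sub>C 1 - a \<in> Inv" using disc by (auto simp: calc_disc_def subset_iff spectrum_def)
    have eq: "z *\<^sub>C 1 - u * a * alg_inv u = u * (z *\<^sub>C 1 - a) * alg_inv u"
      using u by (simp add: left_diff_distrib right_diff_distrib mult_scaleC_left mult_scaleC_right alg_inv_right)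
    have "resolvent (u * a * alg_inv u) z = u * resolvent a z * alg_inv u"
      unfolding resolvent_def eq
      by (rule alg_inv_unique)
        (simp_all add: mult.assoc alg_inv_cancel_left alg_inv_cancel_right alg_inv_right u z)
    thus "f z *\<^sub>C resolvent (u * a * alg_inv u) z = u * (f z *\<^sub>C resolvent a z) * alg_inv u"
      by (simp add: mult_scaleC_left mult_scaleC_right)
  qed
  also have "\<dots> = u * alg_contour_integral (circlepath c r) (\<lambda>z. f z *\<^sub>C resolvent a z) * alg_inv u"
    by (rule alg_contour_integral_linear[OF bl _ calc_disc_integrable[OF disc f]])
      (simp add: mult_scaleC_left mult_scaleC_right)
  finally show ?thesis
    by (simp add: circle_calc_def mult_scaleC_left mult_scaleC_right)
qed

text \<open>A half-plane is the increasing union of the discs inside it that touch its boundary, so a compact subset lies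
  in one of them; moving the boundary by \<open>\<delta>/2\<close> keeps the closed disc inside the half-plane. The choice
  \<open>c = B\<^sup>2/\<delta> + \<delta>\<close> makes the centre large enough.\<close>

lemma halfplane_disc:
  assumes "spectrum a \<subseteq> {z. Re z > 0}"
  obtains c r where "calc_disc a {z. Re z > 0} c r"
proof -
  \<comment> \<open>The point \<open>1\<close> is added to have a nonempty set, over which a minimum of the real part exists.\<close>
  define K where "K = insert 1 (spectrum a)"
  have K: "compact K" "K \<noteq> {}" "K \<subseteq> {z. Re z > 0}"
    using assms compact_spectrum[of a] by (auto simp: K_def)
  obtain k where k: "k \<in> K" "\<And>z. z \<in> K \<Longrightarrow> Re k \<le> Re z"
    using continuous_attains_inf[OF K(1,2), of Re] continuous_on_Re[OF continuous_on_id] by metis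
  define \<delta> where "\<delta> = Re k"
  have \<delta>: "\<delta> > 0" using k(1) K(3) by (auto simp: \<delta>_def)
  obtain B where B: "B > 0" "\<And>z. z \<in> K \<Longrightarrow> cmod z \<le> B"
    using compact_imp_bounded[OF K(1)] unfolding bounded_pos by blast
  define c where "c = B\<^sup>2 / \<delta> + \<delta>"
  define r where "r = c - \<delta> / 2"
  have c: "c > \<delta>" using \<delta> B by (simp add: c_def)
  hence r: "r > 0" using \<delta> by (simp add: r_def)
  have "cball (of_real c) r \<subseteq> {z. Re z > 0}"
  proof
    fix z assume "z \<in> cball (complex_of_real c) r"
    hence "\<bar>Re (of_real c - z)\<bar> \<le> r"
      using abs_Re_le_cmod[of "of_real c - z"] by (auto simp: dist_norm)
    thus "z \<in> {z. Re z > 0}" using \<delta> by (simp add: r_def)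
  qed
  moreover have "K \<subseteq> ball (of_real c) r"
  proof
    fix z assume z: "z \<in> K"
    have "(cmod (of_real c - z))\<^sup>2 = (cmod z)\<^sup>2 - 2 * c * Re z + c\<^sup>2"
      unfolding cmod_power2 by (simp add: power2_eq_square algebra_simps)
    also have "\<dots> \<le> B\<^sup>2 - 2 * c * \<delta> + c\<^sup>2"
    proof -
      have "(cmod z)\<^sup>2 \<le> B\<^sup>2" using B(2)[OF z] by (intro power_mono) auto
      moreover have "c * \<delta> \<le> c * Re z" using k(2)[OF z] c \<delta> by (intro mult_left_mono) (auto simp: \<delta>_def)
      ultimately show ?thesis by linarith
    qed
    also have "\<dots> < r\<^sup>2"
    proof -
      have "c * \<delta> = B\<^sup>2 + \<delta>\<^sup>2" using \<delta> by (simp add: c_def power2_eq_square algebra_simps)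
      moreover have "r\<^sup>2 = c\<^sup>2 - c * \<delta> + \<delta>\<^sup>2 / 4" by (simp add: r_def power2_eq_square algebra_simps)
      moreover have "\<delta>\<^sup>2 > 0" using \<delta> by simp
      ultimately show ?thesis by (simp add: mult.assoc)
    qed
    finally have "cmod (of_real c - z) < r" using r by (simp add: power2_less_imp_less)
    thus "z \<in> ball (of_real c) r" by (simp add: dist_norm)
  qed
  ultimately show ?thesis
    using r by (intro that[of "of_real c" r])
      (auto simp: calc_disc_def K_def open_halfspace_Re_gt convex_halfspace_Re_gt)
qed

text \<open>A weak substitute for \<open>\<sigma>(h + k) \<subseteq> \<sigma>(h) + \<sigma>(k)\<close>, which avoids maximal ideals. Formally the
  inverse of \<open>h + k\<close> is the function \<open>1/(z + k)\<close> evaluated at \<open>z = h\<close>, that is, up to the factor \<open>2 \<pi> \<i>\<close>, the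
  integral \<open>W\<close> of \<open>(z + k)\<^sup>-\<^sup>1 (z - h)\<^sup>-\<^sup>1\<close>. Indeed \<open>h + k = (z + k) - (z - h)\<close> turns \<open>(h + k) W\<close> into
  the integral of \<open>(z - h)\<^sup>-\<^sup>1 - (z + k)\<^sup>-\<^sup>1\<close>, whose second part is holomorphic in the half-plane.\<close>

lemma Inv_add_commuting_halfplane:
  fixes h k :: "'a::complex_banach_algebra"
  assumes hk: "h * k = k * h"
    and h: "spectrum h \<subseteq> {z. Re z > 0}" and k: "spectrum k \<subseteq> {z. Re z > 0}"
  shows "h + k \<in> Inv"
proof -
  obtain c r where disc: "calc_disc h {z. Re z > 0} c r" by (rule halfplane_disc[OF h])
  define U where "U = {z::complex. Re z > 0}"
  have U: "open U" "convex U" "0 < r" "cball c r \<subseteq> U" "spectrum h \<subseteq> ball c r"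
    using disc by (auto simp: calc_disc_def U_def)
  define R where "R = resolvent h"
  define Q where "Q = resolvent (- k)"
  have k': "U \<subseteq> - spectrum (- k)"
    using k by (fastforce simp: U_def spectrum_uminus)
  have cQ: "cdiff_on Q U"
    unfolding Q_def by (rule cdiff_on_subset[OF cdiff_on_resolvent k'])
  have cR: "cdiff_on R (U - spectrum h)"
    unfolding R_def by (rule cdiff_on_subset[OF cdiff_on_resolvent]) auto
  have op: "open (U - spectrum h)" using U(1) closed_spectrum by (rule open_Diff)
  have im: "path_image (circlepath c r) \<subseteq> U - spectrum h" "path_image (circlepath c r) \<subseteq> U"
    using U by (auto simp: subset_iff)
  have key: "(h + k) * (Q z * R z) = R z - Q z" "(Q z * R z) * (h + k) = R z - Q z"
    if z: "z \<in> U - spectrum h" for z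
  proof -
    have ih: "z *\<^sub>C 1 - h \<in> Inv" and ik: "z *\<^sub>C 1 - (- k) \<in> Inv"
      using z k' by (auto simp: spectrum_def)
    have Rc: "R z * x = x * R z" if "h * x = x * h" for x
      unfolding R_def resolvent_def
      by (rule alg_inv_commute[OF ih])
        (simp add: left_diff_distrib right_diff_distrib mult_scaleC_left mult_scaleC_right that)
    have Qc: "Q z * x = x * Q z" if "k * x = x * k" for x
      unfolding Q_def resolvent_def
      by (rule alg_inv_commute[OF ik])
        (simp add: distrib_left distrib_right mult_scaleC_left mult_scaleC_right that)
    have "(h + k) * (Q z * R z) = ((z *\<^sub>C 1 - (- k)) - (z *\<^sub>C 1 - h)) * (Q z * R z)"
      by (simp add: add.commute)
    also have "\<dots> = ((z *\<^sub>C 1 - (- k)) * Q z) * R z - (z *\<^sub>C 1 - h) * (Q z * R z)"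
      by (simp only: left_diff_distrib mult.assoc)
    also have "(z *\<^sub>C 1 - (- k)) * Q z = 1"
      unfolding Q_def resolvent_def by (rule alg_inv_right[OF ik])
    also have "(z *\<^sub>C 1 - h) * (Q z * R z) = Q z * ((z *\<^sub>C 1 - h) * R z)"
      using Qc[of h] hk by (simp add: left_diff_distrib right_diff_distrib mult_scaleC_left mult_scaleC_right
          flip: mult.assoc)
    also have "(z *\<^sub>C 1 - h) * R z = 1"
      unfolding R_def resolvent_def by (rule alg_inv_right[OF ih])
    finally show 1: "(h + k) * (Q z * R z) = R z - Q z" by simp
    have sum: "R z * (h + k) = (h + k) * R z" "Q z * (h + k) = (h + k) * Q z"
      using hk by (intro Rc Qc; simp add: distrib_left distrib_right)+
    have "(Q z * R z) * (h + k) = Q z * ((h + k) * R z)"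
      by (simp only: mult.assoc sum(1))
    also have "\<dots> = (h + k) * (Q z * R z)"
      by (simp only: mult.assoc[symmetric] sum(2))
    finally show "(Q z * R z) * (h + k) = R z - Q z" using 1 by simp
  qed
  have iR: "alg_contour_integrable (circlepath c r) R"
    by (rule alg_contour_integrable_cdiff[OF op cR valid_path_circlepath im(1)])
  have iQ: "alg_contour_integrable (circlepath c r) Q"
    by (rule alg_contour_integrable_cdiff[OF U(1) cQ valid_path_circlepath im(2)])
  have iQR: "alg_contour_integrable (circlepath c r) (\<lambda>z. Q z * R z)"
    by (rule alg_contour_integrable_cdiff[OF op cdiff_on_mult[OF cdiff_on_subset[OF cQ] cR] valid_path_circlepath im(1)])
      auto
  define W where "W = alg_contour_integral (circlepath c r) (\<lambda>z. Q z * R z)"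
  define \<kappa> where "\<kappa> = 2 * complex_of_real pi * \<i>"
  have val: "alg_contour_integral (circlepath c r) (\<lambda>z. R z - Q z) = \<kappa> *\<^sub>C 1"
    using alg_contour_integral_diff[OF iR iQ] alg_contour_integral_resolvent[OF U(3,5)]
      alg_Cauchy_convex[OF U(1,2) cQ valid_path_circlepath im(2)]
    by (simp add: R_def \<kappa>_def)
  have "(h + k) * W = alg_contour_integral (circlepath c r) (\<lambda>z. R z - Q z)"
    unfolding W_def alg_contour_integral_mult_left[OF iQR, symmetric]
    by (rule alg_contour_integral_cong) (use key(1) im in auto)
  moreover have "W * (h + k) = alg_contour_integral (circlepath c r) (\<lambda>z. R z - Q z)"
    unfolding W_def alg_contour_integral_mult_right[OF iQR, symmetric]
    by (rule alg_contour_integral_cong) (use key(2) im in auto)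
  ultimately show ?thesis
    using val by (intro InvI[of _ "(1 / \<kappa>) *\<^sub>C W"])
      (simp_all add: mult_scaleC_left mult_scaleC_right scaleC_scaleC \<kappa>_def)
qed

section \<open>Real powers\<close>

text \<open>The two open quadrants, joined through the points far to the right, are dense in the set.\<close>

lemma connected_halfplane_diff_reals:
  assumes "compact K" "K \<subseteq> \<real>"
  shows "connected ({z. Re z > 0} - K)"
proof -
  obtain M where M: "M > 0" "\<And>z. z \<in> K \<Longrightarrow> cmod z \<le> M"
    using compact_imp_bounded[OF assms(1)] unfolding bounded_pos by blast
  define A B C where "A = {z. Re z > 0} \<inter> {z. Im z > 0}" and "B = {z. Re z > 0} \<inter> {z. Im z < 0}"
    and "C = {z. Re z > M}"
  have conn: "connected A" "connected B" "connected C"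
    unfolding A_def B_def C_def
    by (intro convex_connected convex_Int convex_halfspace_Re_gt convex_halfspace_Im_gt convex_halfspace_Im_lt)+
  have "Complex (M + 1) 1 \<in> A \<inter> C" "Complex (M + 1) (-1) \<in> (A \<union> C) \<inter> B"
    using M(1) by (auto simp: A_def B_def C_def)
  hence "connected ((A \<union> C) \<union> B)"
    using conn by (intro connected_Un) blast+
  moreover have "(A \<union> C) \<union> B \<subseteq> {z. Re z > 0} - K"
  proof -
    have "z \<notin> K" if "Im z \<noteq> 0" for z using that assms(2) by (auto simp: complex_is_Real_iff)
    moreover have "z \<notin> K" if "Re z > M" for z
      using that M(2)[of z] complex_Re_le_cmod[of z] by auto
    ultimately show ?thesis using M(1) by (auto simp: A_def B_def C_def)
  qed
  moreover have "{z. Re z > 0} - K \<subseteq> closure ((A \<union> C) \<union> B)"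
  proof
    fix z assume z: "z \<in> {z. Re z > 0} - K"
    show "z \<in> closure ((A \<union> C) \<union> B)"
    proof (cases "Im z = 0")
      case False
      hence "z \<in> (A \<union> C) \<union> B" using z by (simp add: A_def B_def linorder_neq_iff) linarith
      thus ?thesis by (rule subsetD[OF closure_subset])
    next
      case True
      show ?thesis
        unfolding closure_approachable
      proof (intro allI impI)
        fix e :: real assume "e > 0"
        thus "\<exists>y\<in>(A \<union> C) \<union> B. dist y z < e"
          using z True by (intro bexI[of _ "z + \<i> * of_real (e / 2)"]) (auto simp: A_def dist_norm norm_mult)
      qed
    qed
  qed
  ultimately show ?thesis by (rule connected_intermediate_closure)
qed

text \<open>Run along \<open>g\<close>, cross over to the circle, run along the circle backwards and return along the
  crossing path. This closed path winds around no point of \<open>K\<close>, so the homology form of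
  Cauchy's theorem applies. The crossing path exists because \<open>K\<close>, being real, does not disconnect the half-plane.\<close>

lemma contour_integral_encloses_circle:
  fixes f :: "complex \<Rightarrow> complex"
  assumes K: "compact K" "K \<subseteq> \<real>" and g: "encloses g K"
    and circ: "0 < r" "cball c r \<subseteq> {z. Re z > 0}" "K \<subseteq> ball c r"
    and f: "f holomorphic_on {z. Re z > 0} - K"
  shows "contour_integral g f = contour_integral (circlepath c r) f"
proof -
  define U where "U = {z::complex. Re z > 0}"
  define h where "h = circlepath c r"
  have vg: "valid_path g" "pathfinish g = pathstart g" "path_image g \<subseteq> U - K"
    and wg: "\<And>z. z \<in> K \<Longrightarrow> winding_number g z = 1"
    using g by (auto simp: encloses_def U_def)
  have vh: "valid_path h" "pathfinish h = pathstart h" "path_image h \<subseteq> U - K"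
    and wh: "\<And>z. z \<in> K \<Longrightarrow> winding_number h z = 1"
    using circ by (auto simp: h_def U_def dist_norm norm_minus_commute subset_iff intro!: winding_number_circlepath)
  have op: "open (U - K)"
    using K(1) by (auto simp: U_def intro!: open_Diff open_halfspace_Re_gt compact_imp_closed)
  have "pathstart g \<in> U - K" "pathstart h \<in> U - K"
    using vg(3) vh(3) by (auto simp: subset_iff)
  then obtain p where p: "polynomial_function p" "path_image p \<subseteq> U - K" "pathstart p = pathstart g" "pathfinish p = pathstart h"
    using connected_open_polynomial_connected[OF op] connected_halfplane_diff_reals[OF K] unfolding U_def by metis
  have vp: "valid_path p" by (rule valid_path_polynomial_function[OF p(1)])
  define L where "L = (g +++ p) +++ (reversepath h +++ reversepath p)"
  note ends = p(3,4) vg(2) vh(2)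
  have vL: "valid_path L" "pathfinish L = pathstart L" "path_image L \<subseteq> U - K"
    unfolding L_def using vg vh vp p ends
    by (auto simp: path_image_join intro!: valid_path_join)
  have w0: "winding_number L z = 0" if "z \<notin> U - K" for z
  proof (cases "z \<in> K")
    case True
    hence nin: "z \<notin> path_image g" "z \<notin> path_image h" "z \<notin> path_image p"
      using vg(3) vh(3) p(2) by auto
    thus ?thesis
      unfolding L_def using ends vg(1) vh(1) vp wg[OF True] wh[OF True]
      by (simp add: winding_number_join winding_number_reversepath path_image_join valid_path_imp_path)
  next
    case False
    have "convex U" unfolding U_def by (rule convex_halfspace_Re_gt)
    thus ?thesis
      using that False vL by (intro winding_number_zero_outside[where s = U]) (auto simp: valid_path_imp_path)
  qed
  have f': "f holomorphic_on U - K" using f by (simp add: U_def)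
  have int: "f contour_integrable_on q" if "valid_path q" "path_image q \<subseteq> U - K" for q
    by (rule contour_integrable_holomorphic_simple[OF f' op that])
  have "(f has_contour_integral 0) L"
    by (rule Cauchy_theorem_global[OF op f' vL]) (rule w0)
  hence "contour_integral L f = 0" by (rule contour_integral_unique)
  moreover have "contour_integral L f = contour_integral g f + contour_integral p f
      + (- contour_integral h f + - contour_integral p f)"
    unfolding L_def using ends vg vh vp p(2) int
    by (simp add: contour_integral_join contour_integral_reversepath contour_integrable_reversepath
        contour_integrable_join)
  ultimately show ?thesis by (simp add: h_def)
qed

text \<open>Some enclosing curve exists, namely a circle, so the choice in the definition of the power picks
  an enclosing curve; by independence of the curve its integral can be taken over that circle.\<close>

lemma apowr_eq_circle_calc:
  fixes a :: "'a::complex_banach_algebra"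
  assumes sp: "spectrum a \<subseteq> \<real>" and disc: "calc_disc a {z. Re z > 0} c r"
  shows "a apowr \<alpha> = circle_calc c r (\<lambda>z. z powr of_real \<alpha>) a"
proof -
  define U where "U = {z::complex. Re z > 0}"
  have U: "open U" "0 < r" "cball c r \<subseteq> U" "spectrum a \<subseteq> ball c r"
    using disc by (auto simp: calc_disc_def U_def)
  have hol: "(\<lambda>z. z powr of_real \<alpha>) holomorphic_on U"
    unfolding U_def by (intro holomorphic_intros) (auto simp: complex_nonpos_Reals_iff)
  have "encloses (circlepath c r) (spectrum a)"
    using U by (auto simp: encloses_def U_def dist_norm norm_minus_commute subset_iff intro!: winding_number_circlepath)
  hence enc: "encloses (SOME g. encloses g (spectrum a)) (spectrum a)" (is "encloses ?g _")
    by (rule someI[where P = "\<lambda>g. encloses g (spectrum a)"])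
  have "alg_contour_integral ?g (\<lambda>z. z powr of_real \<alpha> *\<^sub>C resolvent a z)
      = alg_contour_integral (circlepath c r) (\<lambda>z. z powr of_real \<alpha> *\<^sub>C resolvent a z)"
  proof (rule alg_contour_integral_eqI)
    show "alg_contour_integrable ?g (\<lambda>z. z powr of_real \<alpha> *\<^sub>C resolvent a z)"
      by (rule alg_contour_integrable_resolvent[OF hol U(1)]) (use enc in \<open>auto simp: encloses_def U_def\<close>)
    show "alg_contour_integrable (circlepath c r) (\<lambda>z. z powr of_real \<alpha> *\<^sub>C resolvent a z)"
      by (rule calc_disc_integrable[OF disc hol[unfolded U_def]])
    show "contour_integral ?g (\<lambda>z. \<phi> (z powr of_real \<alpha> *\<^sub>C resolvent a z))
        = contour_integral (circlepath c r) (\<lambda>z. \<phi> (z powr of_real \<alpha> *\<^sub>C resolvent a z))"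
      if "cfunctional \<phi>" for \<phi> :: "'a \<Rightarrow> complex"
      by (rule contour_integral_encloses_circle[OF compact_spectrum sp enc U(2) U(3,4)[unfolded U_def]])
        (rule cfunctional_cdiff_holomorphic[OF that cdiff_on_holomorphic_resolvent[OF hol U(1), unfolded U_def]])
  qed
  thus ?thesis
    by (simp add: apowr_def circle_calc_def resolvent_def)
qed

lemma holomorphic_on_powr_halfplane: "(\<lambda>z. z powr of_real \<alpha>) holomorphic_on {z. Re z > 0}"
  by (intro holomorphic_intros) (auto simp: complex_nonpos_Reals_iff)

definition pos_spectrum :: "'a::complex_banach_algebra \<Rightarrow> bool" where
  "pos_spectrum a \<longleftrightarrow> spectrum a \<subseteq> \<real> \<inter> {z. Re z > 0}"

lemma pos_spectrum_disc:
  assumes "pos_spectrum a"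
  obtains c r where "calc_disc a {z. Re z > 0} c r" "\<And>\<alpha>. a apowr \<alpha> = circle_calc c r (\<lambda>z. z powr of_real \<alpha>) a"
proof -
  have sp: "spectrum a \<subseteq> \<real>" "spectrum a \<subseteq> {z. Re z > 0}"
    using assms by (auto simp: pos_spectrum_def)
  obtain c r where disc: "calc_disc a {z. Re z > 0} c r"
    by (rule halfplane_disc[OF sp(2)])
  show ?thesis
    by (rule that[OF disc apowr_eq_circle_calc[OF sp(1) disc]])
qed

lemma apowr_add:
  assumes "pos_spectrum a"
  shows "a apowr \<alpha> * a apowr \<beta> = a apowr (\<alpha> + \<beta>)"
proof -
  obtain c r where disc: "calc_disc a {z. Re z > 0} c r"
    and eq: "\<And>\<alpha>. a apowr \<alpha> = circle_calc c r (\<lambda>z. z powr of_real \<alpha>) a"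
    by (rule pos_spectrum_disc[OF assms]) blast
  show ?thesis
    unfolding eq circle_calc_mult[OF disc holomorphic_on_powr_halfplane holomorphic_on_powr_halfplane]
    by (rule circle_calc_cong[OF disc]) (auto simp: powr_add)
qed

lemma apowr_0:
  assumes "pos_spectrum a"
  shows "a apowr 0 = 1"
proof -
  obtain c r where disc: "calc_disc a {z. Re z > 0} c r"
    and eq: "\<And>\<alpha>. a apowr \<alpha> = circle_calc c r (\<lambda>z. z powr of_real \<alpha>) a"
    by (rule pos_spectrum_disc[OF assms]) blast
  show ?thesis
    unfolding eq circle_calc_one[OF disc, symmetric]
    by (rule circle_calc_cong[OF disc]) auto
qed

lemma apowr_1:
  assumes "pos_spectrum a"
  shows "a apowr 1 = a"
proof -
  obtain c r where disc: "calc_disc a {z. Re z > 0} c r"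
    and eq: "\<And>\<alpha>. a apowr \<alpha> = circle_calc c r (\<lambda>z. z powr of_real \<alpha>) a"
    by (rule pos_spectrum_disc[OF assms]) blast
  have "circle_calc c r (\<lambda>z. z powr of_real 1) a = circle_calc c r (\<lambda>z. z) a"
    by (rule circle_calc_cong[OF disc]) (auto simp: powr_to_1)
  thus ?thesis by (simp only: eq circle_calc_id[OF disc])
qed

lemma apowr_similar:
  assumes u: "u \<in> Inv" and a: "pos_spectrum a"
  shows "(u * a * alg_inv u) apowr \<alpha> = u * a apowr \<alpha> * alg_inv u"
proof -
  obtain c r where disc: "calc_disc a {z. Re z > 0} c r"
    and eq: "\<And>\<alpha>. a apowr \<alpha> = circle_calc c r (\<lambda>z. z powr of_real \<alpha>) a"
    by (rule pos_spectrum_disc[OF a]) blast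
  have "calc_disc (u * a * alg_inv u) {z. Re z > 0} c r"
    using disc by (simp add: calc_disc_def spectrum_similar[OF u])
  hence "(u * a * alg_inv u) apowr \<alpha> = circle_calc c r (\<lambda>z. z powr of_real \<alpha>) (u * a * alg_inv u)"
    by (intro apowr_eq_circle_calc) (use a spectrum_similar[OF u] in \<open>auto simp: pos_spectrum_def\<close>)
  thus ?thesis
    by (simp only: circle_calc_similar[OF u disc holomorphic_on_powr_halfplane] eq)
qed

section \<open>Selfadjoint square roots\<close>

lemma star_ring_simps [simp]:
  fixes x y :: "'a::banach_star_algebra"
  shows star_uminus: "star (- x) = - star x"
    and star_diff: "star (x - y) = star x - star y"
    and star_one: "star (1::'a) = 1"
proof -
  show neg: "star (- x) = - star x" for x :: 'a
    using star_scaleC[of "-1" x] by simp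
  show "star (x - y) = star x - star y"
    using star_add[of x "- y"] neg[of y] by simp
  have "star (star (1::'a)) = star (1 * star 1)" by simp
  thus "star (1::'a) = 1" unfolding star_mult star_star by simp
qed

declare star_star [simp] star_add [simp] star_mult [simp] star_scaleC [simp]

lemma
  fixes x :: "'a::banach_star_algebra"
  assumes "x \<in> Inv"
  shows Inv_star: "star x \<in> Inv" and star_alg_inv: "star (alg_inv x) = alg_inv (star x)"
proof -
  have *: "star x * star (alg_inv x) = 1" "star (alg_inv x) * star x = 1"
    using assms by (simp_all flip: star_mult add: alg_inv_left alg_inv_right)
  thus "star x \<in> Inv" "star (alg_inv x) = alg_inv (star x)"
    by (auto intro: InvI simp: alg_inv_unique)
qed

lemma spectrum_star: "z \<in> spectrum (star a) \<longleftrightarrow> cnj z \<in> spectrum a"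
proof -
  have "star (z *\<^sub>C 1 - star a) = cnj z *\<^sub>C 1 - a" "star (cnj z *\<^sub>C 1 - a) = z *\<^sub>C 1 - star a"
    by simp_all
  thus ?thesis
    using Inv_star[of "z *\<^sub>C 1 - star a"] Inv_star[of "cnj z *\<^sub>C 1 - a"] by (auto simp: spectrum_iff)
qed

lemma pos_spectrumI:
  fixes a :: "'a::banach_star_algebra"
  assumes "hermitian TYPE('a)" "star a = a" "\<And>t. of_real t \<in> spectrum a \<Longrightarrow> 0 < t"
  shows "pos_spectrum a"
proof -
  have "spectrum a \<subseteq> \<real>" using assms(1,2) by (auto simp: hermitian_def)
  moreover have "Re z > 0" if "z \<in> spectrum a" for z
    using that calculation assms(3)[of "Re z"] by (auto simp: subset_iff elim!: Reals_cases)
  ultimately show ?thesis by (auto simp: pos_spectrum_def)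
qed

text \<open>Ford's square root lemma. The holomorphic square root \<open>h\<close> need not be visibly selfadjoint, since
  the involution cannot be moved under the integral. But \<open>h\<^sup>*\<close> is also a square root of \<open>a\<close>, it commutes
  with \<open>a\<close> and hence with \<open>h\<close>, and both have their spectrum in the right half-plane. So \<open>h + h\<^sup>*\<close> is
  invertible, and \<open>(h - h\<^sup>*) (h + h\<^sup>*) = 0\<close> forces \<open>h = h\<^sup>*\<close>.\<close>

lemma exists_selfadjoint_sqrt:
  fixes a :: "'a::banach_star_algebra"
  assumes "star a = a" "pos_spectrum a"
  obtains h where "star h = h" "h * h = a" "h \<in> Inv"
proof -
  define U where "U = {z::complex. Re z > 0}"
  have sp: "spectrum a \<subseteq> {z. Re z > 0}" using assms(2) by (auto simp: pos_spectrum_def)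
  obtain c r where disc: "calc_disc a U c r" unfolding U_def by (rule halfplane_disc[OF sp])
  have hol: "csqrt holomorphic_on U"
    unfolding U_def by (rule holomorphic_on_csqrt') (auto simp: complex_nonpos_Reals_iff)
  define h where "h = circle_calc c r csqrt a"
  define k where "k = star h"
  have "h * h = circle_calc c r (\<lambda>z. csqrt z * csqrt z) a"
    unfolding h_def by (rule circle_calc_mult[OF disc hol hol])
  also have "\<dots> = circle_calc c r (\<lambda>z. z) a"
    by (rule circle_calc_cong[OF disc]) (simp flip: power2_eq_square)
  finally have hh: "h * h = a" by (simp add: circle_calc_id[OF disc])
  have kk: "k * k = a" using arg_cong[OF hh, of star] by (simp add: k_def assms(1))
  have "a * k = k * a" by (simp add: mult.assoc flip: kk)
  hence hk: "h * k = k * h" unfolding h_def by (rule circle_calc_commute[OF disc hol])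
  have "Re (csqrt z) > 0" if "Re z > 0" for z
  proof -
    have "Re (csqrt z) \<noteq> 0"
    proof
      assume "Re (csqrt z) = 0"
      hence "Re ((csqrt z)\<^sup>2) \<le> 0" by (simp add: power2_eq_square)
      thus False using that by simp
    qed
    thus ?thesis using Re_csqrt[of z] by simp
  qed
  hence sh: "spectrum h \<subseteq> {z. Re z > 0}"
    using spectrum_circle_calc[OF disc hol] unfolding h_def U_def by blast
  hence sk: "spectrum k \<subseteq> {z. Re z > 0}"
    by (fastforce simp: k_def spectrum_star)
  have "(h - k) * (h + k) = 0" using hh kk hk by (simp add: algebra_simps)
  hence "(h - k) * ((h + k) * alg_inv (h + k)) = 0" by (simp flip: mult.assoc)
  hence "h = k" using alg_inv_right[OF Inv_add_commuting_halfplane[OF hk sh sk]] by simp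
  hence "star h = h" by (simp add: k_def)
  moreover have "0 \<notin> spectrum a" using sp by auto
  hence "h * h \<in> Inv" using Inv_uminus_iff[of a] by (simp add: spectrum_iff hh)
  hence "h \<in> Inv" using Inv_left_factor by blast
  ultimately show ?thesis using hh that by blast
qed

section \<open>The inequality of Ptak\<close>

lemma Inv_one_plus_skew:
  fixes s :: "'a::banach_star_algebra"
  assumes herm: "hermitian TYPE('a)" and s: "star s = - s"
  shows "1 + s \<in> Inv"
proof -
  define k where "k = \<i> *\<^sub>C s"
  have "star k = k" using s by (simp add: k_def)
  hence "spectrum k \<subseteq> \<real>" using herm by (auto simp: hermitian_def)
  hence "- \<i> \<notin> spectrum k" by (auto simp: complex_is_Real_iff)
  hence "\<i> *\<^sub>C ((- \<i>) *\<^sub>C 1 - k) \<in> Inv" by (intro Inv_scaleC) (auto simp: spectrum_iff)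
  also have "\<i> *\<^sub>C ((- \<i>) *\<^sub>C 1 - k) = 1 + s"
    unfolding scaleC_diff_right scaleC_scaleC k_def by simp
  finally show ?thesis .
qed

text \<open>With \<open>h\<^sup>2 = 1 - x\<^sup>* x\<close> and \<open>s = x\<^sup>* - x\<close> one has
  \<open>(1 + x\<^sup>*) (1 - x) = h\<^sup>2 + s = h (1 + h\<^sup>-\<^sup>1 s h\<^sup>-\<^sup>1) h\<close>. The element \<open>h\<^sup>-\<^sup>1 s h\<^sup>-\<^sup>1\<close> is skew-adjoint, so in a Hermitian
  algebra its spectrum is imaginary.\<close>

lemma Inv_one_plus_star_mult_one_minus:
  fixes x :: "'a::banach_star_algebra"
  assumes herm: "hermitian TYPE('a)" and lt: "\<And>t. of_real t \<in> spectrum (star x * x) \<Longrightarrow> t < 1"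
  shows "(1 + star x) * (1 - x) \<in> Inv"
proof -
  define a where "a = 1 - star x * x"
  have sa: "star a = a" by (simp add: a_def)
  have "0 < t" if "of_real t \<in> spectrum a" for t
  proof -
    have "of_real t - 1 \<in> spectrum (- (star x * x))"
      using that spectrum_one_plus[of "of_real t" "- (star x * x)"] by (simp add: a_def)
    hence "of_real (1 - t) \<in> spectrum (star x * x)" by (simp add: spectrum_uminus)
    thus ?thesis using lt[of "1 - t"] by simp
  qed
  then obtain h where h: "star h = h" "h * h = a" "h \<in> Inv"
    using exists_selfadjoint_sqrt[OF sa pos_spectrumI[OF herm sa]] by blast
  define g where "g = alg_inv h"
  have sg: "star g = g" using star_alg_inv[OF h(3)] h(1) by (simp add: g_def)
  define s where "s = star x - x"
  have "1 + g * s * g \<in> Inv"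
    by (rule Inv_one_plus_skew[OF herm]) (simp add: sg s_def algebra_simps)
  hence "h * (1 + g * s * g) * h \<in> Inv" using h(3) by (simp add: Inv_mult)
  also have "h * (1 + g * s * g) * h = h * h + (h * g) * s * (g * h)"
    by (simp add: algebra_simps)
  also have "\<dots> = a + s"
    using h(2,3) by (simp add: g_def alg_inv_left alg_inv_right)
  also have "\<dots> = (1 + star x) * (1 - x)"
    by (simp add: a_def s_def algebra_simps)
  finally show ?thesis .
qed

text \<open>The preceding lemma makes \<open>1 - x\<close> left invertible. Applied to \<open>-x\<^sup>*\<close> it makes \<open>1 - x\<close> right
  invertible, because \<open>x x\<^sup>*\<close> and \<open>x\<^sup>* x\<close> have the same nonzero spectrum.\<close>

lemma Inv_one_minus_of_star_mult_less:
  fixes x :: "'a::banach_star_algebra"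
  assumes herm: "hermitian TYPE('a)" and lt: "\<And>t. of_real t \<in> spectrum (star x * x) \<Longrightarrow> t < 1"
  shows "1 - x \<in> Inv"
proof (rule Inv_left_factor)
  show "(1 + star x) * (1 - x) \<in> Inv"
    by (rule Inv_one_plus_star_mult_one_minus[OF herm lt])
  have lt': "t < 1" if t: "of_real t \<in> spectrum (star (- star x) * (- star x))" for t
  proof (cases "t = 0")
    case False
    with t show ?thesis using lt[of t] spectrum_swap[of "of_real t" x "star x"] by simp
  qed simp
  have "(1 + star (- star x)) * (1 - (- star x)) \<in> Inv"
    by (rule Inv_one_plus_star_mult_one_minus[OF herm lt'])
  thus "(1 - x) * (1 + star x) \<in> Inv" by simp
qed

text \<open>Ptak's inequality \<open>r(x)\<^sup>2 \<le> r(x\<^sup>* x)\<close>, at the level \<open>1\<close>.\<close>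

lemma spectrum_in_ball_of_star_mult:
  fixes x :: "'a::banach_star_algebra"
  assumes herm: "hermitian TYPE('a)" and ball: "spectrum (star x * x) \<subseteq> ball 0 1"
  shows "spectrum x \<subseteq> ball 0 1"
proof
  fix z assume z: "z \<in> spectrum x"
  show "z \<in> ball 0 1"
  proof (rule ccontr)
    assume "z \<notin> ball 0 1"
    hence z1: "cmod z \<ge> 1" by simp
    hence z0: "z \<noteq> 0" by auto
    define y where "y = (1 / z) *\<^sub>C x"
    have yy: "star y * y = of_real (1 / (cmod z)\<^sup>2) *\<^sub>C (star x * x)"
      by (simp add: y_def mult_scaleC_left mult_scaleC_right scaleC_scaleC flip: complex_norm_square)
    have "1 - y \<in> Inv"
    proof (rule Inv_one_minus_of_star_mult_less[OF herm])
      fix t assume "of_real t \<in> spectrum (star y * y)"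
      hence "of_real t / of_real (1 / (cmod z)\<^sup>2) \<in> spectrum (star x * x)"
        unfolding yy using z0 by (subst (asm) spectrum_scaleC) auto
      hence "of_real (t * (cmod z)\<^sup>2) \<in> ball (0::complex) 1" using ball by auto
      hence "\<bar>t\<bar> * (cmod z)\<^sup>2 < 1" by (simp add: norm_mult norm_power abs_mult del: of_real_mult of_real_power)
      moreover have "\<bar>t\<bar> * 1 \<le> \<bar>t\<bar> * (cmod z)\<^sup>2" using z1 by (intro mult_left_mono) auto
      ultimately show "t < 1" by simp
    qed
    hence "z *\<^sub>C (1 - y) \<in> Inv" using z0 by (rule Inv_scaleC)
    thus False using z z0 by (simp add: spectrum_iff y_def scaleC_diff_right scaleC_scaleC)
  qed
qed

text \<open>Squaring trick: for \<open>x = a b\<close> the element \<open>x\<^sup>* x = b a\<^sup>2 b\<close> has the nonzero spectrum of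
  \<open>a\<^sup>2 b\<^sup>2\<close>, so Ptak's inequality passes the bound from the pair \<open>a\<^sup>2, b\<^sup>2\<close> to the pair \<open>a, b\<close>.\<close>

lemma spectrum_mult_selfadjoint_of_norm:
  fixes a b :: "'a::banach_star_algebra"
  assumes herm: "hermitian TYPE('a)"
  shows "star a = a \<Longrightarrow> star b = b \<Longrightarrow> norm (a ^ (2 ^ n)) * norm (b ^ (2 ^ n)) < 1
    \<Longrightarrow> spectrum (a * b) \<subseteq> ball 0 1"
proof (induction n arbitrary: a b)
  case 0
  hence "norm (a * b) < 1" using norm_mult_ineq[of a b] by simp
  thus ?case using spectrum_norm_le[of _ "a * b"] by fastforce
next
  case (Suc n)
  have pw: "(x * x) ^ (2 ^ n) = x ^ (2 ^ Suc n)" for x :: 'a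
    by (simp add: power_mult power2_eq_square)
  have "spectrum ((a * a) * (b * b)) \<subseteq> ball 0 1"
    by (rule Suc.IH) (use Suc.prems in \<open>simp_all add: pw del: power_Suc\<close>)
  hence "z \<in> ball 0 1" if "z \<in> spectrum (b * ((a * a) * b))" for z
    using that spectrum_swap[of z b "a * a * b"] by (cases "z = 0") (auto simp: mult.assoc)
  hence "spectrum (star (a * b) * (a * b)) \<subseteq> ball 0 1"
    using Suc.prems by (auto simp: mult.assoc)
  thus ?case by (rule spectrum_in_ball_of_star_mult[OF herm])
qed

text \<open>High powers of \<open>a\<close> and \<open>b\<close> have small norm by the spectral radius bound, and the squaring
  trick brings this back to \<open>a b\<close>.\<close>

lemma Inv_one_minus_mult_selfadjoint:
  fixes a b :: "'a::banach_star_algebra"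
  assumes herm: "hermitian TYPE('a)" and sa: "star a = a" "star b = b"
    and ball: "spectrum a \<subseteq> ball 0 1" "spectrum b \<subseteq> ball 0 1"
  shows "1 - a * b \<in> Inv"
proof -
  obtain \<rho> where \<rho>: "0 < \<rho>" "\<rho> < 1" "spectrum a \<subseteq> ball 0 \<rho>"
    using smaller_disc[OF compact_spectrum ball(1)] zero_less_one by blast
  obtain \<sigma> where \<sigma>: "0 < \<sigma>" "\<sigma> < 1" "spectrum b \<subseteq> ball 0 \<sigma>"
    using smaller_disc[OF compact_spectrum ball(2)] zero_less_one by blast
  obtain C where C: "C > 0" "\<And>n. norm (a ^ n) \<le> C * \<rho> ^ n"
    using norm_power_le_of_spectrum[OF \<rho>(3,1)] by blast
  obtain D where D: "D > 0" "\<And>n. norm (b ^ n) \<le> D * \<sigma> ^ n"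
    using norm_power_le_of_spectrum[OF \<sigma>(3,1)] by blast
  have rs: "0 < \<rho> * \<sigma>" "\<rho> * \<sigma> < 1"
    using \<rho> \<sigma> mult_strict_mono[of \<rho> 1 \<sigma> 1] by auto
  obtain n where n: "(\<rho> * \<sigma>) ^ n < 1 / (C * D)"
    using real_arch_pow_inv[of "1 / (C * D)" "\<rho> * \<sigma>"] rs C D by auto
  have "norm (a ^ (2 ^ n)) * norm (b ^ (2 ^ n)) \<le> (C * \<rho> ^ (2 ^ n)) * (D * \<sigma> ^ (2 ^ n))"
    using C D \<rho> by (intro mult_mono) auto
  also have "\<dots> = C * D * (\<rho> * \<sigma>) ^ (2 ^ n)" by (simp add: power_mult_distrib)
  also have "\<dots> \<le> C * D * (\<rho> * \<sigma>) ^ n"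
    using rs C D by (intro mult_left_mono power_decreasing) (auto intro: less_imp_le less_exp)
  also have "\<dots> < C * D * (1 / (C * D))"
    using n C D by (intro mult_strict_left_mono) auto
  also have "\<dots> = 1" using C D by simp
  finally have "spectrum (a * b) \<subseteq> ball 0 1"
    by (rule spectrum_mult_selfadjoint_of_norm[OF herm sa])
  hence "1 \<notin> spectrum (a * b)" by auto
  thus ?thesis by (simp add: spectrum_iff)
qed

section \<open>Positive elements\<close>

definition nonneg :: "'a::banach_star_algebra \<Rightarrow> bool" where
  "nonneg a \<longleftrightarrow> star a = a \<and> (\<forall>t. of_real t \<in> spectrum a \<longrightarrow> 0 \<le> t)"

lemma nonneg_spectrumD: "nonneg a \<Longrightarrow> of_real t \<in> spectrum a \<Longrightarrow> 0 \<le> t"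
  by (simp add: nonneg_def)

lemma nonneg_scaleC:
  assumes "nonneg a" "s > 0"
  shows "nonneg (of_real s *\<^sub>C a)"
proof -
  have "0 \<le> t" if "of_real t \<in> spectrum (of_real s *\<^sub>C a)" for t
  proof -
    have "of_real (t / s) \<in> spectrum a" using that spectrum_scaleC[of "of_real s" "of_real t" a] assms(2) by simp
    hence "0 \<le> t / s" using assms(1) unfolding nonneg_def by blast
    thus ?thesis using assms(2) by (simp add: zero_le_divide_iff)
  qed
  thus ?thesis using assms(1) by (simp add: nonneg_def)
qed

lemma nonneg_Inv_one_plus:
  assumes "nonneg a"
  shows "1 + a \<in> Inv"
proof -
  have "- 1 \<notin> spectrum a" using nonneg_spectrumD[OF assms, of "-1"] by auto
  thus ?thesis using Inv_uminus_iff[of "1 + a"] by (simp add: spectrum_iff)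
qed

text \<open>Here \<open>u = a (1 + a)\<^sup>-\<^sup>1\<close>. The function \<open>t/(1 + t)\<close> maps \<open>[0, \<infinity>)\<close> into \<open>[0, 1)\<close>.\<close>

lemma nonneg_ratio:
  fixes a :: "'a::banach_star_algebra"
  assumes herm: "hermitian TYPE('a)" and a: "nonneg a"
  defines "u \<equiv> 1 - alg_inv (1 + a)"
  shows "star u = u" "spectrum u \<subseteq> ball 0 1" "(1 + a) * u = a" "u * (1 + a) = a"
proof -
  have sa: "star a = a" using a by (simp add: nonneg_def)
  note inv = nonneg_Inv_one_plus[OF a]
  define d where "d = alg_inv (1 + a)"
  have d: "(1 + a) * d = 1" "d * (1 + a) = 1" "d \<in> Inv"
    using inv by (simp_all add: d_def alg_inv_right alg_inv_left Inv_alg_inv)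
  have u: "u = 1 - d" by (simp add: u_def d_def)
  show "(1 + a) * u = a" "u * (1 + a) = a"
    unfolding u right_diff_distrib left_diff_distrib d by simp_all
  have "star d = d" using star_alg_inv[OF inv] sa by (simp add: d_def)
  thus su: "star u = u" by (simp add: u)
  show "spectrum u \<subseteq> ball 0 1"
  proof
    fix z assume z: "z \<in> spectrum u"
    have "z \<in> \<real>" using herm su z by (auto simp: hermitian_def)
    then obtain t where t: "z = of_real t" by (auto elim: Reals_cases)
    have eq: "z *\<^sub>C 1 - u = d * ((z - 1) *\<^sub>C (1 + a) + 1)"
      unfolding u distrib_left[of d "(z - 1) *\<^sub>C (1 + a)"] mult_scaleC_right d by (simp add: scaleC_diff_left)
    show "z \<in> ball 0 1"
    proof (rule ccontr)
      assume "z \<notin> ball 0 1"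
      hence t1: "\<bar>t\<bar> \<ge> 1" by (simp add: t)
      have "t \<noteq> 1" using z d(3) eq t by (auto simp: spectrum_iff)
      have "0 < t / (t - 1)" using t1 \<open>t \<noteq> 1\<close> by (auto simp: zero_less_divide_iff)
      hence "of_real (- (t / (t - 1))) \<notin> spectrum a" using nonneg_spectrumD[OF a] by fastforce
      moreover have "(1 - z) *\<^sub>C (of_real (- (t / (t - 1))) *\<^sub>C 1 - a) = (z - 1) *\<^sub>C (1 + a) + 1"
      proof -
        have "(t - 1) * (t / (t - 1)) = t" using \<open>t \<noteq> 1\<close> by simp
        moreover have "(1 - t) * (- q) = (t - 1) * q" for q by (simp add: algebra_simps)
        ultimately have "(1 - t) * (- (t / (t - 1))) = t" by metis
        hence "of_real ((1 - t) * (- (t / (t - 1)))) = z" by (simp only: t)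
        hence "(1 - z) * of_real (- (t / (t - 1))) = z"
          by (simp only: t of_real_mult of_real_diff of_real_1)
        thus ?thesis
          by (simp only: scaleC_diff_right scaleC_scaleC)
            (simp add: scaleC_diff_left scaleC_add_right algebra_simps)
      qed
      ultimately have "(z - 1) *\<^sub>C (1 + a) + 1 \<in> Inv"
        using Inv_scaleC[of "of_real (- (t / (t - 1))) *\<^sub>C 1 - a" "1 - z"] \<open>t \<noteq> 1\<close>
        by (simp add: spectrum_iff t)
      hence "z *\<^sub>C 1 - u \<in> Inv" unfolding eq using d(3) by (intro Inv_mult)
      thus False using z by (simp add: spectrum_iff)
    qed
  qed
qed

text \<open>The identity behind it is \<open>1 + a + b = (1 + a) (1 - u v) (1 + b)\<close> with \<open>u = a (1 + a)\<^sup>-\<^sup>1\<close> and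
  \<open>v = b (1 + b)\<^sup>-\<^sup>1\<close>, selfadjoint elements of spectral radius less than \<open>1\<close>.\<close>

lemma nonneg_Inv_one_plus_add:
  fixes a b :: "'a::banach_star_algebra"
  assumes herm: "hermitian TYPE('a)" and a: "nonneg a" and b: "nonneg b"
  shows "1 + (a + b) \<in> Inv"
proof -
  define u v where "u = 1 - alg_inv (1 + a)" and "v = 1 - alg_inv (1 + b)"
  note u = nonneg_ratio[OF herm a, folded u_def] and v = nonneg_ratio[OF herm b, folded v_def]
  have "1 - u * v \<in> Inv"
    by (rule Inv_one_minus_mult_selfadjoint[OF herm u(1) v(1) u(2) v(2)])
  hence "(1 + a) * (1 - u * v) * (1 + b) \<in> Inv"
    using nonneg_Inv_one_plus[OF a] nonneg_Inv_one_plus[OF b] by (intro Inv_mult)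
  also have "(1 + a) * (1 - u * v) * (1 + b) = (1 + a) * (1 + b) - ((1 + a) * u) * (v * (1 + b))"
    by (simp only: left_diff_distrib right_diff_distrib mult_1_right mult.assoc)
  also have "\<dots> = 1 + (a + b)"
    unfolding u v by (simp add: algebra_simps)
  finally show ?thesis .
qed

lemma nonneg_add:
  fixes a b :: "'a::banach_star_algebra"
  assumes herm: "hermitian TYPE('a)" and a: "nonneg a" and b: "nonneg b"
  shows "nonneg (a + b)"
proof -
  have "0 \<le> t" if t: "of_real t \<in> spectrum (a + b)" for t
  proof (rule ccontr)
    assume "\<not> 0 \<le> t"
    hence s: "- t > 0" "1 / - t > 0" by simp_all
    have "1 + (of_real (1 / - t) *\<^sub>C a + of_real (1 / - t) *\<^sub>C b) \<in> Inv"
      using nonneg_scaleC[OF a s(2)] nonneg_scaleC[OF b s(2)]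
      by (rule nonneg_Inv_one_plus_add[OF herm])
    hence "of_real t *\<^sub>C (1 + (of_real (1 / - t) *\<^sub>C a + of_real (1 / - t) *\<^sub>C b)) \<in> Inv"
      using s by (intro Inv_scaleC) auto
    also have "of_real t *\<^sub>C (1 + (of_real (1 / - t) *\<^sub>C a + of_real (1 / - t) *\<^sub>C b)) = of_real t *\<^sub>C 1 - (a + b)"
    proof -
      have "complex_of_real t * of_real (1 / - t) = - 1" using s by simp
      thus ?thesis unfolding scaleC_add_right scaleC_scaleC by simp
    qed
    finally show False using t by (simp add: spectrum_iff)
  qed
  thus ?thesis using a b by (simp add: nonneg_def)
qed

text \<open>For \<open>t < 0\<close> the element \<open>t - s\<^sup>2\<close> factors as \<open>(w - s) (w + s)\<close> with \<open>w\<close> purely imaginary.\<close>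

lemma nonneg_square:
  fixes s :: "'a::banach_star_algebra"
  assumes herm: "hermitian TYPE('a)" and s: "star s = s"
  shows "nonneg (s * s)"
proof -
  have "0 \<le> t" if t: "of_real t \<in> spectrum (s * s)" for t
  proof (rule ccontr)
    assume "\<not> 0 \<le> t"
    define w where "w = \<i> * of_real (sqrt (- t))"
    have ww: "w * w = of_real t"
      using \<open>\<not> 0 \<le> t\<close> by (simp add: w_def mult_ac flip: of_real_mult)
    have "w \<notin> \<real>" "- w \<notin> \<real>" using \<open>\<not> 0 \<le> t\<close> by (auto simp: w_def complex_is_Real_iff)
    hence "w *\<^sub>C 1 - s \<in> Inv" "(- w) *\<^sub>C 1 - s \<in> Inv"
      using herm s unfolding hermitian_def by (metis spectrum_iff subsetD)+
    hence "- ((w *\<^sub>C 1 - s) * ((- w) *\<^sub>C 1 - s)) \<in> Inv" by (intro Inv_uminus Inv_mult)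
    also have "- ((w *\<^sub>C 1 - s) * ((- w) *\<^sub>C 1 - s)) = (w * w) *\<^sub>C 1 - s * s"
      by (simp add: algebra_simps mult_scaleC_left mult_scaleC_right scaleC_scaleC scaleC_diff_right)
    finally show False using t by (simp add: spectrum_iff ww)
  qed
  thus ?thesis using s by (simp add: nonneg_def)
qed

section \<open>The Shirali-Ford theorem\<close>

text \<open>For \<open>h = y + y\<^sup>*\<close> and \<open>k = \<i> (y - y\<^sup>*)\<close> the sum is \<open>(h\<^sup>2 + k\<^sup>2)/2\<close>.\<close>

lemma nonneg_star_mult_add_mult_star:
  fixes y :: "'a::banach_star_algebra"
  assumes herm: "hermitian TYPE('a)"
  shows "nonneg (star y * y + y * star y)"
proof -
  define h k where "h = y + star y" and "k = \<i> *\<^sub>C (y - star y)"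
  have sa: "star h = h" "star k = k"
    by (simp_all add: h_def k_def add.commute scaleC_diff_right)
  have "nonneg (h * h + k * k)"
    by (intro nonneg_add[OF herm] nonneg_square[OF herm] sa)
  hence "nonneg (of_real (1/2) *\<^sub>C (h * h + k * k))" by (rule nonneg_scaleC) simp
  also have "h * h + k * k = 2 *\<^sub>C (star y * y + y * star y)"
    unfolding scaleC_2 h_def k_def
    by (simp add: mult_scaleC_left mult_scaleC_right scaleC_scaleC scaleC_diff_right algebra_simps)
  finally show ?thesis by (simp add: scaleC_scaleC)
qed

text \<open>Put \<open>c = x\<^sup>* x\<close> and \<open>y = 2 x (1 + c)\<^sup>-\<^sup>1\<close>. Then \<open>y\<^sup>* y = 4 c (1 + c)\<^sup>-\<^sup>2\<close>, and
  \<open>1 - y\<^sup>* y = ((1 - c) (1 + c)\<^sup>-\<^sup>1)\<^sup>2\<close> is nonnegative, so \<open>\<sigma>(y\<^sup>* y) \<le> 1\<close>. Because \<open>y\<^sup>* y + y y\<^sup>*\<close> is nonnegative,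
  so is \<open>1 + y y\<^sup>*\<close>, and \<open>\<sigma>(y\<^sup>* y) \<ge> -1\<close> as well. Meanwhile the spectral value \<open>-\<delta>\<close> of \<open>c\<close>
  has moved to \<open>-4 \<delta>/(1 - \<delta>)\<^sup>2\<close>. Division of \<open>y\<close> by \<open>\<surd>2\<close> brings the spectrum back into the open disc and leaves a
  factor of at least \<open>2\<close>.\<close>

lemma double_negative_spectral_value:
  fixes x :: "'a::banach_star_algebra"
  assumes herm: "hermitian TYPE('a)" and ball: "spectrum (star x * x) \<subseteq> ball 0 1"
    and mem: "of_real (- \<delta>) \<in> spectrum (star x * x)" and pos: "0 < \<delta>"
  obtains y :: 'a and \<mu> where "spectrum (star y * y) \<subseteq> ball 0 1"
    "of_real (- \<mu>) \<in> spectrum (star y * y)" "2 * \<delta> \<le> \<mu>"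
proof -
  define c where "c = star x * x"
  have sc: "star c = c" by (simp add: c_def)
  have l1: "\<delta> < 1" using subsetD[OF ball mem] pos by simp
  have "- 1 \<notin> spectrum c" using ball by (auto simp: c_def)
  hence inv: "1 + c \<in> Inv" using Inv_uminus_iff[of "1 + c"] by (simp add: spectrum_iff)
  \<comment> \<open>Everything below is a polynomial in \<open>d = (1 + c)\<^sup>-\<^sup>1\<close>, since \<open>c d = 1 - d\<close>.\<close>
  define d where "d = alg_inv (1 + c)"
  have d: "(1 + c) * d = 1" "d * (1 + c) = 1"
    using inv by (simp_all add: d_def alg_inv_right alg_inv_left)
  have cd: "c * d = 1 - d" using d(1) by (simp add: algebra_simps)
  have sd: "star d = d" using star_alg_inv[OF inv] sc by (simp add: d_def)
  define y where "y = 2 *\<^sub>C (x * d)"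
  have "star y * y = 4 *\<^sub>C (d * (c * d))"
    by (simp add: y_def sd c_def mult.assoc mult_scaleC_left mult_scaleC_right scaleC_scaleC)
  hence yy: "star y * y = 4 *\<^sub>C (d - d * d)" by (simp add: cd right_diff_distrib)

  have "star (1 - 2 *\<^sub>C d) = 1 - 2 *\<^sub>C d" by (simp add: sd)
  from nonneg_square[OF herm this]
  have n1: "nonneg (1 - star y * y)"
    by (simp add: yy algebra_simps mult_scaleC_left mult_scaleC_right scaleC_scaleC scaleC_diff_right flip: scaleC_add_left)
  from nonneg_add[OF herm nonneg_star_mult_add_mult_star[OF herm] this, of y]
  have n2: "nonneg (1 + y * star y)" by (simp add: add.commute)
  have bounds: "-1 \<le> t \<and> t \<le> 1" if t: "of_real t \<in> spectrum (star y * y)" for t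
  proof
    have "of_real (1 - t) \<in> spectrum (1 - star y * y)"
      using t spectrum_one_plus[of "of_real (1 - t)" "- (star y * y)"] by (simp add: spectrum_uminus)
    hence "0 \<le> 1 - t" using n1 unfolding nonneg_def by blast
    thus "t \<le> 1" by simp
    show "-1 \<le> t"
    proof (cases "t = 0")
      case False
      hence "of_real t \<in> spectrum (y * star y)" using t spectrum_swap[of "of_real t" y "star y"] by simp
      hence "of_real (1 + t) \<in> spectrum (1 + y * star y)"
        using spectrum_one_plus[of "of_real (1 + t)" "y * star y"] by simp
      hence "0 \<le> 1 + t" using n2 unfolding nonneg_def by blast
      thus ?thesis by simp
    qed simp
  qed

  define \<mu> where "\<mu> = 2 * \<delta> / (1 - \<delta>)\<^sup>2"
  define e where "e = 1 / (1 - \<delta>)"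
  \<comment> \<open>The spectral value \<open>-\<delta>\<close> of \<open>c\<close> corresponds to the value \<open>e = 1/(1 - \<delta>)\<close> of \<open>d\<close>, a root of the
    quadratic polynomial \<open>-2 \<mu> - 4 d + 4 d\<^sup>2 = 4 (d - e) (d - (1 - e))\<close>.\<close>
  have mem_yy: "of_real (- (2 * \<mu>)) \<in> spectrum (star y * y)"
  proof (rule ccontr)
    assume "\<not> ?thesis"
    hence "of_real (- (2 * \<mu>)) *\<^sub>C 1 - star y * y \<in> Inv" by (simp add: spectrum_iff)
    also have "of_real (- (2 * \<mu>)) *\<^sub>C 1 - star y * y
        = 4 *\<^sub>C ((d - of_real e *\<^sub>C 1) * (d - of_real (1 - e) *\<^sub>C 1))"
    proof -
      have e1: "1 - e = - (\<delta> * e)" using l1 by (simp add: e_def diff_divide_eq_iff)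
      have "\<mu> = 2 * (\<delta> * e * e)" by (simp add: e_def \<mu>_def power2_eq_square)
      hence "4 * (e * (1 - e)) = - (2 * \<mu>)" unfolding e1 by simp
      hence "complex_of_real (4 * (e * (1 - e))) = of_real (- (2 * \<mu>))" by (simp only:)
      hence "of_real (- (2 * \<mu>)) = 4 * (complex_of_real e * of_real (1 - e))"
        by (simp only: of_real_mult of_real_numeral)
      moreover have "of_real (1 - e) *\<^sub>C d + of_real e *\<^sub>C d = d"
        unfolding scaleC_add_left[symmetric] of_real_add[symmetric] by simp
      ultimately show ?thesis
        unfolding yy
        by (simp add: left_diff_distrib right_diff_distrib mult_scaleC_left mult_scaleC_right
            scaleC_diff_right scaleC_diff_left scaleC_scaleC scaleC_add_right)
    qed
    finally have "(d - of_real e *\<^sub>C 1) * (d - of_real (1 - e) *\<^sub>C 1) \<in> Inv"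
      by (simp add: Inv_scaleC_iff)
    moreover have "(d - \<beta> *\<^sub>C 1) * (d - \<alpha> *\<^sub>C 1) = (d - \<alpha> *\<^sub>C 1) * (d - \<beta> *\<^sub>C 1)" for \<alpha> \<beta>
      by (simp add: algebra_simps mult_scaleC_left mult_scaleC_right scaleC_diff_right scaleC_scaleC)
    ultimately have "d - of_real e *\<^sub>C 1 \<in> Inv"
      using Inv_left_factor[of "d - of_real e *\<^sub>C 1" "d - of_real (1 - e) *\<^sub>C 1"] by metis
    hence "of_real (1 - \<delta>) *\<^sub>C ((1 + c) * (d - of_real e *\<^sub>C 1)) \<in> Inv"
      using inv l1 by (intro Inv_scaleC Inv_mult) auto
    also have "(1 + c) * (d - of_real e *\<^sub>C 1) = 1 - of_real e *\<^sub>C (1 + c)"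
      by (simp add: right_diff_distrib d mult_scaleC_right)
    also have "of_real (1 - \<delta>) *\<^sub>C (1 - of_real e *\<^sub>C (1 + c)) = of_real (- \<delta>) *\<^sub>C 1 - c"
    proof -
      have "complex_of_real (1 - \<delta>) * of_real e = 1"
        using l1 by (simp add: e_def flip: of_real_mult)
      thus ?thesis
        unfolding scaleC_diff_right scaleC_scaleC by (simp add: scaleC_diff_left)
    qed
    finally show False using mem by (simp add: c_def spectrum_iff)
  qed

  define w where "w = of_real (1 / sqrt 2) *\<^sub>C y"
  have "complex_of_real (1 / sqrt 2) * of_real (1 / sqrt 2) = of_real (1/2)"
    unfolding of_real_mult[symmetric] by simp
  hence ww: "star w * w = of_real (1/2) *\<^sub>C (star y * y)"
    unfolding w_def star_scaleC mult_scaleC_left mult_scaleC_right scaleC_scaleC complex_cnj_complex_of_real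
    by simp
  have sp_ww: "z \<in> spectrum (star w * w) \<longleftrightarrow> 2 * z \<in> spectrum (star y * y)" for z
    unfolding ww by (subst spectrum_scaleC) (simp_all add: mult.commute)
  have "spectrum (star w * w) \<subseteq> ball 0 1"
  proof
    fix z assume z: "z \<in> spectrum (star w * w)"
    moreover have "star (star w * w) = star w * w" by simp
    ultimately have "z \<in> \<real>" using herm unfolding hermitian_def by (metis subsetD)
    then obtain t where t: "z = of_real t" by (auto elim: Reals_cases)
    hence "of_real (2 * t) \<in> spectrum (star y * y)" using z sp_ww by simp
    from bounds[OF this] have "\<bar>t\<bar> < 1" by linarith
    thus "z \<in> ball 0 1" by (simp add: t)
  qed
  moreover have "of_real (- \<mu>) \<in> spectrum (star w * w)"
    using mem_yy by (simp add: sp_ww)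
  moreover have "2 * \<delta> \<le> \<mu>"
  proof -
    have "0 < (1 - \<delta>)\<^sup>2" "(1 - \<delta>)\<^sup>2 \<le> 1" using l1 pos by (auto simp: power_le_one)
    thus ?thesis using pos by (simp add: \<mu>_def pos_le_divide_eq mult_left_le)
  qed
  ultimately show ?thesis by (rule that)
qed

text \<open>After scaling \<open>x\<close>, the spectrum of \<open>x\<^sup>* x\<close> lies in the open unit disc. A negative value there could be doubled
  without end, but it cannot leave the disc.\<close>

lemma Shirali_Ford:
  fixes x :: "'a::banach_star_algebra"
  assumes herm: "hermitian TYPE('a)"
  shows "nonneg (star x * x)"
proof -
  have no_neg: "\<not> of_real (- \<delta>) \<in> spectrum (star y * y)"
    if y: "spectrum (star y * y) \<subseteq> ball 0 1" "0 < \<delta>" for y :: 'a and \<delta>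
  proof
    assume mem: "of_real (- \<delta>) \<in> spectrum (star y * y)"
    have iter: "\<exists>(w::'a) \<mu>. spectrum (star w * w) \<subseteq> ball 0 1 \<and> of_real (- \<mu>) \<in> spectrum (star w * w)
        \<and> 2 ^ n * \<delta> \<le> \<mu>" for n
    proof (induction n)
      case 0
      show ?case using y mem by (intro exI[of _ y] exI[of _ \<delta>]) simp
    next
      case (Suc n)
      then obtain w :: 'a and \<mu> where w: "spectrum (star w * w) \<subseteq> ball 0 1"
        "of_real (- \<mu>) \<in> spectrum (star w * w)" "2 ^ n * \<delta> \<le> \<mu>" by blast
      have "0 < 2 ^ n * \<delta>" using y(2) by simp
      hence "\<mu> > 0" using w(3) by linarith
      then obtain v :: 'a and \<nu> where v: "spectrum (star v * v) \<subseteq> ball 0 1"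
        "of_real (- \<nu>) \<in> spectrum (star v * v)" "2 * \<mu> \<le> \<nu>"
        using double_negative_spectral_value[OF herm w(1,2)] by blast
      have "2 ^ Suc n * \<delta> \<le> \<nu>" using w(3) v(3) by simp
      with v show ?case by blast
    qed
    obtain n where n: "1 / \<delta> < 2 ^ n" using real_arch_pow[of 2 "1 / \<delta>"] by auto
    obtain w :: 'a and \<mu> where w: "spectrum (star w * w) \<subseteq> ball 0 1"
      "of_real (- \<mu>) \<in> spectrum (star w * w)" "2 ^ n * \<delta> \<le> \<mu>" using iter by blast
    have "1 < 2 ^ n * \<delta>" using n y(2) by (simp add: field_simps)
    moreover have "\<mu> < 1" using subsetD[OF w(1,2)] by simp
    ultimately show False using w(3) by simp
  qed
  have "0 \<le> t" if t: "of_real t \<in> spectrum (star x * x)" for t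
  proof (rule ccontr)
    assume neg: "\<not> 0 \<le> t"
    define N where "N = norm (star x * x) + 1"
    have N: "N > 0" unfolding N_def by (smt (verit) norm_ge_zero)
    define s where "s = 1 / sqrt N"
    have s: "s > 0" "s * s = 1 / N" using N by (simp_all add: s_def)
    define y where "y = of_real s *\<^sub>C x"
    have yy: "star y * y = of_real (1 / N) *\<^sub>C (star x * x)"
      unfolding s(2)[symmetric] by (simp add: y_def mult_scaleC_left mult_scaleC_right scaleC_scaleC)
    have sp: "z \<in> spectrum (star y * y) \<longleftrightarrow> z * of_real N \<in> spectrum (star x * x)" for z
      unfolding yy using N by (subst spectrum_scaleC) simp_all
    have "spectrum (star y * y) \<subseteq> ball 0 1"
    proof
      fix z assume "z \<in> spectrum (star y * y)"
      hence "cmod (z * of_real N) \<le> norm (star x * x)" unfolding sp by (rule spectrum_norm_le)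
      hence "cmod z * N \<le> norm (star x * x)" using N by (simp add: norm_mult)
      also have "\<dots> < 1 * N" by (simp add: N_def)
      finally have "cmod z < 1" using N by (simp only: mult_less_cancel_right_pos)
      thus "z \<in> ball 0 1" by simp
    qed
    moreover have "of_real (- (- t / N)) \<in> spectrum (star y * y)"
      using t N by (simp add: sp)
    moreover have "0 < - t / N" using neg N by (intro divide_pos_pos) auto
    ultimately show False using no_neg by blast
  qed
  thus ?thesis by (simp add: nonneg_def)
qed

lemma pos_spectrum_star_mult:
  fixes x :: "'a::banach_star_algebra"
  assumes herm: "hermitian TYPE('a)" and x: "x \<in> Inv"
  shows "pos_spectrum (star x * x)"
proof (rule pos_spectrumI[OF herm])
  fix t assume t: "of_real t \<in> spectrum (star x * x)"
  have "star x * x \<in> Inv" using x by (simp add: Inv_mult Inv_star)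
  hence "t \<noteq> 0" using t Inv_uminus_iff[of "star x * x"] by (auto simp: spectrum_iff)
  moreover have "0 \<le> t" using Shirali_Ford[OF herm, of x] t unfolding nonneg_def by blast
  ultimately show "0 < t" by simp
qed simp

section \<open>The weighted geometric means\<close>

lemma modulus_power2:
  fixes x :: "'a::banach_star_algebra"
  assumes "hermitian TYPE('a)" "x \<in> Inv"
  shows "(modulus x)\<^sup>2 = star x * x"
  using apowr_add[of "star x * x" "1/2" "1/2"] apowr_1[of "star x * x"] pos_spectrum_star_mult[OF assms]
  by (simp add: modulus_def power2_eq_square)

theorem theorem1:
  fixes x y :: "'a::banach_star_algebra" and \<nu> :: real
  assumes "hermitian TYPE('a)"
    and "x \<in> Inv" and "y \<in> Inv"
  shows "quad_wgeo_mean \<nu> x y = wgeo_mean \<nu> ((modulus x)\<^sup>2) ((modulus y)\<^sup>2)"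
proof -
  note herm = assms(1) and x = assms(2) and y = assms(3)
  define a b where "a = star x * x" and "b = star y * y"
  define p q where "p = a apowr (1/2)" and "q = a apowr (-1/2)"
  have pa: "pos_spectrum a" unfolding a_def by (rule pos_spectrum_star_mult[OF herm x])
  have pp: "p * p = a" and pq: "p * q = 1" and qp: "q * p = 1"
    using apowr_add[OF pa, of "1/2" "1/2"] apowr_add[OF pa, of "1/2" "-1/2"] apowr_add[OF pa, of "-1/2" "1/2"]
    by (simp_all add: p_def q_def apowr_0[OF pa] apowr_1[OF pa])
  define u where "u = x * q"
  have u: "u \<in> Inv" unfolding u_def by (intro Inv_mult x InvI[OF qp pq])
  have up: "u * p = x" by (simp add: u_def mult.assoc qp)
  have ui: "alg_inv u = p * alg_inv x"
  proof (rule alg_inv_unique)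
    show "u * (p * alg_inv x) = 1" by (simp only: mult.assoc[symmetric] up alg_inv_right[OF x])
    show "p * alg_inv x * u = 1" by (simp only: u_def mult.assoc alg_inv_cancel_left[OF x] pq)
  qed
  have sx: "star x = p * alg_inv u"
  proof -
    have "p * alg_inv u = a * alg_inv x" by (simp add: ui pp flip: mult.assoc)
    thus ?thesis by (simp add: a_def mult.assoc alg_inv_right x)
  qed
  have isx: "alg_inv (star x) = u * q"
  proof (rule alg_inv_unique)
    show "star x * (u * q) = 1" by (simp only: sx mult.assoc alg_inv_cancel_left[OF u] pq)
    have "u * q * star x = u * (q * p) * alg_inv u" by (simp only: sx mult.assoc)
    thus "u * q * star x = 1" by (simp add: qp alg_inv_right[OF u])
  qed
  have ix: "alg_inv x = q * alg_inv u" by (simp add: ui qp flip: mult.assoc)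

  define m where "m = q * b * q"
  have mid: "alg_inv (star x) * star y * y * alg_inv x = u * m * alg_inv u"
    by (simp add: isx ix m_def b_def mult.assoc)
  define v where "v = y * alg_inv x"
  have "star v * v = alg_inv (star x) * star y * y * alg_inv x"
    by (simp add: v_def star_alg_inv[OF x] mult.assoc)
  hence "pos_spectrum (u * m * alg_inv u)"
    using pos_spectrum_star_mult[OF herm, of v] x y by (simp add: mid v_def Inv_mult Inv_alg_inv)
  hence pm: "pos_spectrum m" by (simp add: pos_spectrum_def spectrum_similar[OF u])

  have "quad_wgeo_mean \<nu> x y = star x * (u * m apowr \<nu> * alg_inv u) * x"
    by (simp add: quad_wgeo_mean_def mid apowr_similar[OF u pm])
  also have "\<dots> = p * (alg_inv u * u) * m apowr \<nu> * (alg_inv u * u) * p"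
    unfolding sx by (simp only: mult.assoc up)
  also have "\<dots> = p * m apowr \<nu> * p" by (simp add: alg_inv_left u)
  also have "\<dots> = wgeo_mean \<nu> a b" by (simp add: wgeo_mean_def p_def q_def m_def)
  finally show ?thesis
    by (simp add: a_def b_def modulus_power2 herm x y)
qed

end
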